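(* Let $T$ be a finite tree with $\Delta(T)\le 4$ such that $b(T)=k$. Then $|V(T)|\ge |V(T_k)|$.
   Context: Grid: the rectangular grid of horizontal and vertical lines through integer points. An s-model of a tree $T$ with $\Delta(T)\le 4$ is a drawing of $T$ in the grid with vertices at distinct grid points and each edge a straight (bend-free) horizontal or vertical grid segment, segments of distinct edges meeting only at common endpoints; $\mathcal{M}(T)$ is the set of s-models. The number of bends of a path in $\mathcal{M}$ is the number of turns between horizontal and vertical of the concatenation of the segments of its edges; $b_{\mathcal{M}}(u,w)$ is this number for the $u$–$w$ path; $b(\mathcal{M})=\max\{b_{\mathcal{M}}(u,w):u,w\text{ leaves}\}$ and $b(T)=\min_{\mathcal{M}\in\mathcal{M}(T)}b(\mathcal{M})$. For $p,v\in V(T)$, $b^{\ell}_{\mathcal{M}}(p,v)=\max\{b_{\mathcal{M}}(p,f): f\text{ a leaf of }T\text{ whose path from }p\text{ contains }v\}$. For $v\in V(T)$, list $N(v)$ padded with virtual neighbours to four entries $u^1_{\mathcal{M}}(v),\dots,u^4_{\mathcal{M}}(v)$ (each occupying a grid direction at $v$, virtual ones the free directions), with $b^i_{\mathcal{M}}(v)=b^{\ell}_{\mathcal{M}}(v,u^i_{\mathcal{M}}(v))$ for real and $-1$ for virtual neighbours, ordered nonincreasingly; $v$ is balanced if $u^1_{\mathcal{M}}(v),u^2_{\mathcal{M}}(v)$ lie on a common grid line through $v$, and $\mathcal{M}$ is balanced if all its vertices are balanced. $T^f_0$ is the one-vertex tree; for $d\ge1$, $T^f_d$ is a tree with the least number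 of vertices among all trees having a vertex $r$ with $N(r)=\{r_1,r_2\}$ and a balanced s-model $\mathcal{M}$ with $b^{\ell}_{\mathcal{M}}(r,r_1)=b^{\ell}_{\mathcal{M}}(r,r_2)=d-1$; its root is $r$ (for $d=0$, the unique vertex). The tree $T_k$: $T_0$ is the one-vertex tree; for $k\ge1$, take a path $v_0,v_1,\dots,v_{k+1}$ and, for each $1\le i\le k$, add a disjoint copy of $T^f_{d_i}$ with $d_i=\min\{i-1,k-i\}$ and join $v_i$ to the root of that copy by an edge. *)

theory Defs
  imports "HOL-Analysis.Analysis"
begin

record 'a graph =
  verts :: "'a set"
  edges :: "'a set set"

definition simple_graph :: "'a graph \<Rightarrow> bool" where
  "simple_graph G \<longleftrightarrow> finite (verts G) \<and> (\<forall>e\<in>edges G. e \<subseteq> verts G \<and> card e = 2)"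

definition nbrs :: "'a graph \<Rightarrow> 'a \<Rightarrow> 'a set" where
  "nbrs G v = {u. {v, u} \<in> edges G}"

definition deg :: "'a graph \<Rightarrow> 'a \<Rightarrow> nat" where
  "deg G v = card (nbrs G v)"

definition gpath :: "'a graph \<Rightarrow> 'a \<Rightarrow> 'a list \<Rightarrow> 'a \<Rightarrow> bool" where
  "gpath G u xs w \<longleftrightarrow> xs \<noteq> [] \<and> hd xs = u \<and> last xs = w \<and> distinct xs \<and>
     set xs \<subseteq> verts G \<and> successively (\<lambda>x y. {x, y} \<in> edges G) xs"

definition gcycle :: "'a graph \<Rightarrow> 'a list \<Rightarrow> bool" where
  "gcycle G xs \<longleftrightarrow> length xs \<ge> 3 \<and> gpath G (hd xs) xs (last xs) \<and> {last xs, hd xs} \<in> edges G"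

definition tree :: "'a graph \<Rightarrow> bool" where
  "tree G \<longleftrightarrow> simple_graph G \<and> verts G \<noteq> {} \<and>
     (\<forall>u\<in>verts G. \<forall>w\<in>verts G. \<exists>xs. gpath G u xs w) \<and> (\<nexists>xs. gcycle G xs)"

definition leaf :: "'a graph \<Rightarrow> 'a \<Rightarrow> bool" where
  "leaf G v \<longleftrightarrow> v \<in> verts G \<and> deg G v = 1"

definition the_path :: "'a graph \<Rightarrow> 'a \<Rightarrow> 'a \<Rightarrow> 'a list" where
  "the_path G u w = (THE xs. gpath G u xs w)"

text \<open>Since the edges are drawn as straight segments, a model is determined by the grid points
  of the vertices.\<close>

type_synonym 'a model = "'a \<Rightarrow> int \<times> int"

definition grid_point :: "int \<times> int \<Rightarrow> real \<times> real" where
  "grid_point p = (real_of_int (fst p), real_of_int (snd p))"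

definition horizontal :: "'a model \<Rightarrow> 'a \<Rightarrow> 'a \<Rightarrow> bool" where
  "horizontal M u v \<longleftrightarrow> snd (M u) = snd (M v)"

definition vertical :: "'a model \<Rightarrow> 'a \<Rightarrow> 'a \<Rightarrow> bool" where
  "vertical M u v \<longleftrightarrow> fst (M u) = fst (M v)"

definition segment :: "'a model \<Rightarrow> 'a \<Rightarrow> 'a \<Rightarrow> (real \<times> real) set" where
  "segment M u v = closed_segment (grid_point (M u)) (grid_point (M v))"

definition s_model :: "'a graph \<Rightarrow> 'a model \<Rightarrow> bool" where
  "s_model G M \<longleftrightarrow> inj_on M (verts G) \<and>
     (\<forall>u v. {u, v} \<in> edges G \<longrightarrow> horizontal M u v \<or> vertical M u v) \<and>
     (\<forall>u v u' v'. {u, v} \<in> edges G \<longrightarrow> {u', v'} \<in> edges G \<longrightarrow> {u, v} \<noteq> {u', v'} \<longrightarrow>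
        segment M u v \<inter> segment M u' v' \<subseteq> grid_point ` M ` ({u, v} \<inter> {u', v'}))"

text \<open>The orientation can only change at a vertex of the path, so the turns are counted at the
  inner vertices of the path.\<close>

definition bends :: "'a model \<Rightarrow> 'a list \<Rightarrow> nat" where
  "bends M xs = card {i. i + 2 < length xs \<and>
     horizontal M (xs ! i) (xs ! (i + 1)) \<noteq> horizontal M (xs ! (i + 1)) (xs ! (i + 2))}"

definition path_bends :: "'a graph \<Rightarrow> 'a model \<Rightarrow> 'a \<Rightarrow> 'a \<Rightarrow> nat" where
  "path_bends G M u w = bends M (the_path G u w)"

text \<open>On finite sets of natural numbers \<open>Sup\<close> is the maximum, with \<open>Sup {} = 0\<close>; the latter only
  matters for the one-vertex tree, which has no leaf.\<close>

definition model_bends :: "'a graph \<Rightarrow> 'a model \<Rightarrow> nat" where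
  "model_bends G M = Sup {path_bends G M u w | u w. leaf G u \<and> leaf G w}"

definition bend_number :: "'a graph \<Rightarrow> nat" where
  "bend_number G = (INF M\<in>{M. s_model G M}. model_bends G M)"

definition leaf_bends :: "'a graph \<Rightarrow> 'a model \<Rightarrow> 'a \<Rightarrow> 'a \<Rightarrow> nat" where
  "leaf_bends G M p v = Sup {path_bends G M p f | f. leaf G f \<and> v \<in> set (the_path G p f)}"

text \<open>The four (real or virtual) neighbours of a vertex correspond to the four grid directions at
  this vertex; a neighbour is virtual iff no edge leaves the vertex in its direction.\<close>

datatype direction = East | North | West | South

primrec dir_vec :: "direction \<Rightarrow> int \<times> int" where
  "dir_vec East = (1, 0)"
| "dir_vec North = (0, 1)"
| "dir_vec West = (-1, 0)"
| "dir_vec South = (0, -1)"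

definition nbr_in_dir :: "'a graph \<Rightarrow> 'a model \<Rightarrow> 'a \<Rightarrow> direction \<Rightarrow> 'a \<Rightarrow> bool" where
  "nbr_in_dir G M v \<delta> u \<longleftrightarrow> u \<in> nbrs G v \<and>
     (\<exists>t>0. M u = (fst (M v) + t * fst (dir_vec \<delta>), snd (M v) + t * snd (dir_vec \<delta>)))"

definition dir_bends :: "'a graph \<Rightarrow> 'a model \<Rightarrow> 'a \<Rightarrow> direction \<Rightarrow> int" where
  "dir_bends G M v \<delta> =
     (if \<exists>u. nbr_in_dir G M v \<delta> u then int (leaf_bends G M v (THE u. nbr_in_dir G M v \<delta> u)) else -1)"

definition collinear_dirs :: "direction \<Rightarrow> direction \<Rightarrow> bool" where
  "collinear_dirs \<delta> \<epsilon> \<longleftrightarrow> {\<delta>, \<epsilon>} \<subseteq> {East, West} \<or> {\<delta>, \<epsilon>} \<subseteq> {North, South}"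

text \<open>A list of four distinct directions enumerates all of them. A vertex is balanced if the
  condition holds for some nonincreasing order, i.e. ties may be broken arbitrarily (otherwise no
  leaf could be balanced, its three virtual neighbours being tied).\<close>

definition balanced_vertex :: "'a graph \<Rightarrow> 'a model \<Rightarrow> 'a \<Rightarrow> bool" where
  "balanced_vertex G M v \<longleftrightarrow>
     (\<exists>\<delta>s. length \<delta>s = 4 \<and> distinct \<delta>s \<and> sorted_wrt (\<ge>) (map (dir_bends G M v) \<delta>s) \<and>
       collinear_dirs (\<delta>s ! 0) (\<delta>s ! 1))"

definition balanced :: "'a graph \<Rightarrow> 'a model \<Rightarrow> bool" where
  "balanced G M \<longleftrightarrow> (\<forall>v\<in>verts G. balanced_vertex G M v)"

definition Tf_candidate :: "nat \<Rightarrow> 'a graph \<Rightarrow> 'a \<Rightarrow> bool" where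
  "Tf_candidate d G r \<longleftrightarrow> tree G \<and> r \<in> verts G \<and>
     (\<exists>r\<^sub>1 r\<^sub>2 M. r\<^sub>1 \<noteq> r\<^sub>2 \<and> nbrs G r = {r\<^sub>1, r\<^sub>2} \<and> s_model G M \<and> balanced G M \<and>
        leaf_bends G M r r\<^sub>1 = d - 1 \<and> leaf_bends G M r r\<^sub>2 = d - 1)"

text \<open>Every finite tree is isomorphic to one with vertices in \<open>nat\<close>, so it suffices to minimise
  over those.\<close>

definition is_Tf :: "nat \<Rightarrow> nat graph \<Rightarrow> nat \<Rightarrow> bool" where
  "is_Tf d G r \<longleftrightarrow>
     (if d = 0 then verts G = {r} \<and> edges G = {}
      else Tf_candidate d G r \<and>
        (\<forall>G' :: nat graph. \<forall>r'. Tf_candidate d G' r' \<longrightarrow> card (verts G) \<le> card (verts G')))"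

definition Tf :: "nat \<Rightarrow> nat graph \<times> nat" where
  "Tf d = (SOME (G, r). is_Tf d G r)"

text \<open>\<open>Inl j\<close> is the path vertex \<open>v\<^sub>j\<close>, and \<open>Inr (i, x)\<close> is the vertex \<open>x\<close> of the copy
  attached to \<open>v\<^sub>i\<close>.\<close>

definition Tk :: "nat \<Rightarrow> (nat + nat \<times> nat) graph" where
  "Tk k =
     (if k = 0 then \<lparr>verts = {Inl 0}, edges = {}\<rparr>
      else let F = (\<lambda>i. Tf (min (i - 1) (k - i))) in
        \<lparr>verts = Inl ` {0..k + 1} \<union> (\<Union>i\<in>{1..k}. (\<lambda>x. Inr (i, x)) ` verts (fst (F i))),
         edges = {{Inl j, Inl (j + 1)} | j. j \<le> k} \<union>
           (\<Union>i\<in>{1..k}. (\<lambda>e. (\<lambda>x. Inr (i, x)) ` e) ` edges (fst (F i))) \<union>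
           {{Inl i, Inr (i, snd (F i))} | i. i \<in> {1..k}}\<rparr>)"

end

theory Submission
  imports Defs
begin

text \<open>
  Any local rule for which neighbours are collinear at each vertex is realised by an s-model, so draw
  \<open>T\<close> with the two largest branches (by number of vertices) collinear at every vertex. Some path
  between two leaves has \<open>t \<ge> k\<close> bends there. At a bend, one of the two largest branches lies off
  the path, so it is at least as large as the smaller of the two branches containing the ends of the
  path. While the branch behind is the smaller one, it more than doubles at every bend, and likewise
  from the other end. Cutting the path between the two regimes, with \<open>a\<close> bends on one side and
  \<open>b = t - a\<close> on the other, gives \<open>|V(T)| \<ge> (2\<^sup>a\<^sup>+\<^sup>1 - 1) + (2\<^sup>b\<^sup>+\<^sup>1 - 1)\<close>.
  Conversely, the complete binary tree of depth \<open>d\<close> is a candidate for \<open>T\<^sup>f\<^sub>d\<close>, so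
  \<open>T\<^sup>f\<^sub>d\<close> has at most \<open>2\<^sup>d\<^sup>+\<^sup>1 - 1\<close> vertices. Summing the geometric series, where
  \<open>min (i - 1) (k - i)\<close> is at most \<open>i - 1\<close> for \<open>i \<le> a\<close> and at most \<open>k - i\<close> afterwards, bounds
  \<open>|V(T\<^sub>k)|\<close> from above by the same quantity.
\<close>

section \<open>Paths and branches of trees\<close>

text \<open>Connectivity inside a vertex set, as a closure of steps rather than by simple paths, so
  that it composes freely. With S the vertices other than v it describes the components left by
  deleting v. Both ends of every step lie in S.\<close>

definition reach :: "'a graph \<Rightarrow> 'a set \<Rightarrow> 'a \<Rightarrow> 'a \<Rightarrow> bool" where
  "reach G S = (\<lambda>x y. x \<in> S \<and> y \<in> S \<and> {x, y} \<in> edges G)\<^sup>*\<^sup>*"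

lemma reach_refl [simp]: "reach G S x x"
  by (simp add: reach_def)

lemma reach_step: "{x, y} \<in> edges G \<Longrightarrow> x \<in> S \<Longrightarrow> y \<in> S \<Longrightarrow> reach G S x y"
  by (auto simp: reach_def)

lemma reach_trans: "reach G S x y \<Longrightarrow> reach G S y z \<Longrightarrow> reach G S x z"
  unfolding reach_def by (rule rtranclp_trans)

lemma reach_sym: "reach G S x y \<Longrightarrow> reach G S y x"
  unfolding reach_def
  by (rule sympD[OF symp_rtranclp]) (auto simp: symp_def insert_commute)

lemma reach_mono: "reach G S x y \<Longrightarrow> S \<subseteq> S' \<Longrightarrow> reach G S' x y"
  unfolding reach_def by (erule rtranclp_mono[THEN predicate2D, rotated]) auto

lemma reach_in: "reach G S x y \<Longrightarrow> x \<in> S \<Longrightarrow> y \<in> S"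
  unfolding reach_def by (induction rule: rtranclp_induct) auto

lemma gpath_imp_reach: "gpath G a p b \<Longrightarrow> set p \<subseteq> S \<Longrightarrow> reach G S a b"
proof (induction p arbitrary: a)
  case (Cons x p)
  show ?case
  proof (cases p)
    case Nil
    then show ?thesis using Cons.prems by (auto simp: gpath_def)
  next
    case (Cons y q)
    then have "gpath G y p b" "{x, y} \<in> edges G" "a = x"
      using Cons.prems by (auto simp: gpath_def)
    then show ?thesis
      using Cons.IH[of y] Cons.prems Cons reach_trans reach_step[of x y G S] by fastforce
  qed
qed (simp add: gpath_def)

text \<open>Prepend one vertex at a time; if the new vertex already lies on the path, keep only the
  part from that occurrence on, which stays simple.\<close>

lemma reach_imp_gpath:
  assumes "reach G S a b" "b \<in> S" "S \<subseteq> verts G"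
  shows "\<exists>p. gpath G a p b \<and> set p \<subseteq> S"
  using assms(1) unfolding reach_def
proof (induction rule: converse_rtranclp_induct)
  case base
  then show ?case using assms by (intro exI[of _ "[b]"]) (auto simp: gpath_def)
next
  case (step a c)
  then obtain p where p: "gpath G c p b" "set p \<subseteq> S" by blast
  show ?case
  proof (cases "a \<in> set p")
    case True
    then obtain q r where "p = q @ a # r" by (auto simp: in_set_conv_decomp)
    then have "gpath G a (a # r) b \<and> set (a # r) \<subseteq> S"
      using p by (auto simp: gpath_def successively_append_iff)
    then show ?thesis by blast
  next
    case False
    then have "gpath G a (a # p) b \<and> set (a # p) \<subseteq> S"
      using p step assms by (cases p) (auto simp: gpath_def)
    then show ?thesis by blast
  qed
qed

lemma edge_verts:
  assumes "tree G" "{x, y} \<in> edges G"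
  shows "x \<in> verts G" "y \<in> verts G" "x \<noteq> y"
proof -
  have "{x, y} \<subseteq> verts G" "card {x, y} = 2"
    using assms unfolding tree_def simple_graph_def by blast+
  then show "x \<in> verts G" "y \<in> verts G" "x \<noteq> y" by auto
qed

text \<open>Acyclicity in the form used below: a path inside S between distinct a and b would be
  closed to a cycle by f, which lies outside S.\<close>

lemma tree_nbr_unique:
  assumes "tree G" "f \<notin> S" "S \<subseteq> verts G" "b \<in> S" "reach G S a b"
    "{f, a} \<in> edges G" "{f, b} \<in> edges G"
  shows "a = b"
proof (rule ccontr)
  assume "a \<noteq> b"
  obtain p where p: "gpath G a p b" "set p \<subseteq> S"
    using reach_imp_gpath[OF assms(5,4,3)] by blast
  have "length p \<ge> 2" using p \<open>a \<noteq> b\<close> by (cases p; cases "tl p") (auto simp: gpath_def)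
  moreover have "gpath G f (f # p) b"
    using p assms edge_verts[OF assms(1,6)] by (cases p) (auto simp: gpath_def)
  ultimately have "gcycle G (f # p)"
    using p assms(7) by (auto simp: gcycle_def gpath_def insert_commute)
  then show False using assms(1) by (auto simp: tree_def)
qed

text \<open>Both second vertices are joined to w without the common start, so
  \<open>tree_nbr_unique\<close> identifies them, and the tails agree by induction.\<close>

lemma gpath_unique:
  assumes "tree G" "gpath G u xs w" "gpath G u ys w"
  shows "xs = ys"
  using assms(2,3)
proof (induction xs arbitrary: u ys)
  case Nil
  then show ?case by (simp add: gpath_def)
next
  case (Cons x xs)
  then obtain ys' where ys: "ys = u # ys'" "x = u" by (cases ys) (auto simp: gpath_def)
  show ?case
  proof (cases "xs = [] \<or> ys' = []")
    case True
    then show ?thesis using Cons.prems ys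
      by (auto simp: gpath_def) (metis last_in_set)+
  next
    case False
    then obtain a as b bs where l: "xs = a # as" "ys' = b # bs" by (meson neq_Nil_conv)
    have p: "gpath G a xs w" "gpath G b ys' w" "u \<notin> set xs" "u \<notin> set ys'"
      "{u, a} \<in> edges G" "{u, b} \<in> edges G"
      using Cons.prems ys l by (auto simp: gpath_def)
    let ?S = "verts G - {u}"
    have "set xs \<subseteq> ?S" "set ys' \<subseteq> ?S" using p by (auto simp: gpath_def)
    then have "reach G ?S a w" "reach G ?S b w" using p gpath_imp_reach by metis+
    then have "reach G ?S a b" by (blast intro: reach_sym reach_trans)
    moreover have "b \<in> ?S" using \<open>set ys' \<subseteq> ?S\<close> l by auto
    ultimately have "a = b" using tree_nbr_unique[OF assms(1), of u ?S b a] p by auto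
    then show ?thesis using Cons.IH[of a ys'] p ys by auto
  qed
qed

lemma the_path_eq: "tree G \<Longrightarrow> gpath G u xs w \<Longrightarrow> the_path G u w = xs"
  unfolding the_path_def by (blast intro: gpath_unique)

lemma tree_gpath:
  assumes "tree G" "u \<in> verts G" "w \<in> verts G"
  shows "gpath G u (the_path G u w) w"
proof -
  obtain xs where "gpath G u xs w" using assms unfolding tree_def by blast
  then show ?thesis using the_path_eq[OF assms(1)] by simp
qed

lemma tree_reach:
  assumes "tree G" "u \<in> verts G" "w \<in> verts G"
  shows "reach G (verts G) u w"
  using gpath_imp_reach[OF tree_gpath[OF assms]] tree_gpath[OF assms] by (auto simp: gpath_def)

lemma tree_finite: "tree G \<Longrightarrow> finite (verts G)"
  by (simp add: tree_def simple_graph_def)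

section \<open>Branches at a vertex: the components left after deleting it, and their sizes\<close>

definition branch :: "'a graph \<Rightarrow> 'a \<Rightarrow> 'a \<Rightarrow> 'a set" where
  "branch G v a = {x. reach G (verts G - {v}) a x}"

context
  fixes G :: "'a graph"
  assumes tree: "tree G"
begin

lemma branch_self [simp]: "a \<in> branch G v a"
  by (simp add: branch_def)

lemma branch_verts:
  assumes "{v, a} \<in> edges G"
  shows "branch G v a \<subseteq> verts G - {v}"
  using reach_in edge_verts[OF tree assms] unfolding branch_def by fastforce

lemma branch_finite: "{v, a} \<in> edges G \<Longrightarrow> finite (branch G v a)"
  using branch_verts tree_finite[OF tree] by (meson finite_Diff finite_subset)

lemma card_branch_pos: "{v, a} \<in> edges G \<Longrightarrow> card (branch G v a) \<ge> 1"
  using branch_finite[of v a] branch_self[of a v] by (metis Suc_leI One_nat_def card_gt_0_iff empty_iff)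

lemma branch_disjoint:
  assumes "{v, a} \<in> edges G" "{v, b} \<in> edges G" "a \<noteq> b"
  shows "branch G v a \<inter> branch G v b = {}"
proof (rule ccontr)
  assume "\<not> ?thesis"
  then have "reach G (verts G - {v}) a b"
    unfolding branch_def by (auto intro: reach_sym reach_trans)
  then show False
    using tree_nbr_unique[OF tree, of v "verts G - {v}" b a] assms edge_verts[OF tree assms(2)] by auto
qed

text \<open>A walk inside the branch of a never meets b, which lies in another branch at v, so
  prefixing it with v keeps it clear of b.\<close>

lemma branch_subset:
  assumes "{v, a} \<in> edges G" "{v, b} \<in> edges G" "a \<noteq> b"
  shows "branch G v a \<subseteq> branch G b v"
proof
  fix x assume "x \<in> branch G v a"
  then have "reach G (verts G - {v}) a x" by (simp add: branch_def)
  then have "reach G (verts G - {b}) v x \<and> x \<in> branch G v a" unfolding reach_def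
  proof (induction rule: rtranclp_induct)
    case base
    then show ?case
      using assms edge_verts[OF tree assms(1)] edge_verts[OF tree assms(2)]
        reach_step[of v a G "verts G - {b}"] unfolding reach_def by auto
  next
    case (step y z)
    have z: "z \<in> branch G v a"
      using step reach_trans[of G "verts G - {v}" a y z] reach_step[of y z G "verts G - {v}"]
      by (auto simp: branch_def)
    have "b \<notin> branch G v a"
      using branch_disjoint[OF assms] branch_self by blast
    then have "y \<noteq> b" "z \<noteq> b" using z step by auto
    then show ?case using z step by (auto intro: rtranclp.rtrancl_into_rtrancl)
  qed
  then show "x \<in> branch G b v" by (simp add: branch_def)
qed

lemma card_branch_ge:
  assumes "{v, a} \<in> edges G" "{v, b} \<in> edges G" "a \<noteq> b"
  shows "card (branch G v a) + 1 \<le> card (branch G b v)"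
proof -
  have "insert v (branch G v a) \<subseteq> branch G b v"
    using branch_subset[OF assms] branch_self by auto
  then have "card (insert v (branch G v a)) \<le> card (branch G b v)"
    using assms by (intro card_mono branch_finite) (auto simp: insert_commute)
  then show ?thesis using branch_verts[OF assms(1)] branch_finite[OF assms(1)] by (subst (asm) card_insert_disjoint) auto
qed

text \<open>The gain at a bend: a third branch c joins the part behind; the 1 counts v
  itself.\<close>

lemma card_branch_ge2:
  assumes "{v, a} \<in> edges G" "{v, b} \<in> edges G" "{v, c} \<in> edges G" "a \<noteq> b" "c \<noteq> b" "a \<noteq> c"
  shows "card (branch G v a) + card (branch G v c) + 1 \<le> card (branch G b v)"
proof -
  have "insert v (branch G v a \<union> branch G v c) \<subseteq> branch G b v"
    using branch_subset assms branch_self by auto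
  then have "card (insert v (branch G v a \<union> branch G v c)) \<le> card (branch G b v)"
    using assms by (intro card_mono branch_finite) (auto simp: insert_commute)
  then show ?thesis
    using branch_verts[OF assms(1)] branch_verts[OF assms(3)] branch_disjoint[OF assms(1,3,6)]
      branch_finite[OF assms(1)] branch_finite[OF assms(3)]
    by (subst (asm) card_insert_disjoint) (auto simp: card_Un_disjoint)
qed

text \<open>Whatever v reaches without a is v itself or lies in another branch at v, and those miss
  the branch of a.\<close>

lemma branch_opposite_disjoint:
  assumes "{v, a} \<in> edges G"
  shows "branch G v a \<inter> branch G a v = {}"
proof -
  have *: "x = v \<or> (\<exists>b. b \<noteq> a \<and> {v, b} \<in> edges G \<and> x \<in> branch G v b)" if "x \<in> branch G a v" for x
    using that unfolding branch_def mem_Collect_eq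
    unfolding reach_def
  proof (induction rule: rtranclp_induct)
    case (step y z)
    show ?case
    proof (cases "y = v \<or> z = v")
      case True
      then show ?thesis using step by auto
    next
      case False
      then obtain b where "b \<noteq> a" "{v, b} \<in> edges G" "reach G (verts G - {v}) b y"
        using step by (auto simp: reach_def)
      moreover have "reach G (verts G - {v}) y z" using step False by (intro reach_step) auto
      ultimately show ?thesis using reach_trans unfolding reach_def[symmetric] by metis
    qed
  qed simp
  show ?thesis using * branch_disjoint[OF assms] branch_verts[OF assms] by blast
qed

lemma card_branch_opposite:
  assumes "{v, a} \<in> edges G"
  shows "card (branch G v a) + card (branch G a v) \<le> card (verts G)"
proof -
  have e: "{a, v} \<in> edges G" using assms by (simp add: insert_commute)
  have "card (branch G v a \<union> branch G a v) \<le> card (verts G)"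
    using branch_verts[OF assms] branch_verts[OF e] tree_finite[OF tree] by (intro card_mono) auto
  then show ?thesis
    using branch_opposite_disjoint[OF assms] branch_finite[OF assms] branch_finite[OF e]
    by (simp add: card_Un_disjoint)
qed

end

text \<open>\<open>F i\<close> and \<open>G i\<close> are the sizes of the two sides of the \<open>i\<close>-th edge of a path, and \<open>A\<close> are
  the edges followed by a bend; \<open>j\<close> is the edge at which the smaller side changes.\<close>

lemma turns_bound:
  fixes F G :: "nat \<Rightarrow> nat"
  assumes "l \<ge> 1" "A \<subseteq> {i. Suc i < l}"
    and pos: "\<And>i. i < l \<Longrightarrow> F i \<ge> 1 \<and> G i \<ge> 1"
    and mono: "\<And>i. Suc i < l \<Longrightarrow> F i \<le> F (Suc i) \<and> G (Suc i) \<le> G i"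
    and turn: "\<And>i. i \<in> A \<Longrightarrow> F i + min (F i) (G (Suc i)) + 1 \<le> F (Suc i) \<and>
      G (Suc i) + min (F i) (G (Suc i)) + 1 \<le> G i"
  obtains j a b where "j < l" "a + b = card A" "2 ^ (a + 1) \<le> F j + 1" "2 ^ (b + 1) \<le> G j + 1"
proof -
  have finA: "finite A" by (rule finite_subset[of _ "{..<l}"]) (use assms(2) in auto)
  \<comment> \<open>The vertex between edges j and \<open>Suc j\<close> separates the sides
    \<open>F j\<close> and \<open>G (Suc j)\<close>; j is the first place where the side behind is
    the larger. The disjunct \<open>Suc j \<ge> l\<close> stops the search at the last edge.\<close>
  define j where "j = (LEAST j. Suc j \<ge> l \<or> F j > G (Suc j))"
  have "Suc (l - 1) \<ge> l \<or> F (l - 1) > G (Suc (l - 1))" by auto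
  then have j: "Suc j \<ge> l \<or> F j > G (Suc j)" "j \<le> l - 1"
    unfolding j_def
    using LeastI[of "\<lambda>j. Suc j \<ge> l \<or> F j > G (Suc j)" "l - 1"]
      Least_le[of "\<lambda>j. Suc j \<ge> l \<or> F j > G (Suc j)" "l - 1"] by blast+
  have before: "F i \<le> G (Suc i)" if "i < j" for i
    using not_less_Least[OF that[unfolded j_def]] by auto
  \<comment> \<open>Before j the minimum in \<open>turn\<close> is \<open>F i\<close>, so
    \<open>F i + 1\<close> at least doubles at each bend.\<close>
  have up: "2 ^ (card (A \<inter> {..<i}) + 1) \<le> F i + 1" if "i \<le> j" for i
    using that
  proof (induction i)
    case 0
    then show ?case using pos[of 0] assms(1) by auto
  next
    case (Suc i)
    then have IH: "2 ^ (card (A \<inter> {..<i}) + 1) \<le> F i + 1" by simp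
    show ?case
    proof (cases "i \<in> A")
      case True
      then have "A \<inter> {..<Suc i} = insert i (A \<inter> {..<i})" by auto
      then show ?thesis using IH turn[OF True] before[of i] Suc.prems by simp
    next
      case False
      then have "A \<inter> {..<Suc i} = A \<inter> {..<i}" by (auto simp: less_Suc_eq)
      moreover have "Suc i < l" using Suc.prems j(2) assms(1) by linarith
      ultimately show ?thesis using IH mono[of i] by simp
    qed
  qed
  have Fm: "F j \<le> F i" if "j \<le> i" "i < l" for i
    using that by (induction i rule: dec_induct) (use mono in \<open>auto intro: order_trans\<close>)
  have Gm: "G i \<le> G (Suc j)" if "Suc j \<le> i" "i < l" for i
    using that by (induction i rule: dec_induct) (use mono in \<open>auto intro: order_trans\<close>)
  \<comment> \<open>From j on, monotonicity keeps \<open>G (Suc i)\<close> below \<open>F i\<close>,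
    so now \<open>G\<close> grows in the same way, read from the last edge backwards.\<close>
  have down: "2 ^ (card (A \<inter> {i..}) + 1) \<le> G i + 1" if "i \<le> l - 1" "j \<le> i" for i
    using that
  proof (induction i rule: inc_induct)
    case base
    have "A \<inter> {l - 1..} = {}" using assms(2) by auto
    then show ?case using pos[of "l - 1"] assms(1) by auto
  next
    case (step i)
    then have IH: "2 ^ (card (A \<inter> {Suc i..}) + 1) \<le> G (Suc i) + 1" by simp
    have "Suc i < l" using step by auto
    then have "G (Suc i) < F i" using Fm[of i] Gm[of "Suc i"] j step.prems by auto
    show ?case
    proof (cases "i \<in> A")
      case True
      then have "A \<inter> {i..} = insert i (A \<inter> {Suc i..})" by auto
      then show ?thesis using IH turn[OF True] \<open>G (Suc i) < F i\<close> finA by simp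
    next
      case False
      then have "A \<inter> {i..} = A \<inter> {Suc i..}" by (auto simp: Suc_le_eq order_less_le)
      then show ?thesis using IH mono[OF \<open>Suc i < l\<close>] by simp
    qed
  qed
  have "card (A \<inter> {..<j} \<union> A \<inter> {j..}) = card (A \<inter> {..<j}) + card (A \<inter> {j..})"
    using finA by (intro card_Un_disjoint) auto
  moreover have "A \<inter> {..<j} \<union> A \<inter> {j..} = A" by auto
  ultimately have "card A = card (A \<inter> {..<j}) + card (A \<inter> {j..})" by simp
  then show ?thesis using that[of j "card (A \<inter> {..<j})" "card (A \<inter> {j..})"] up[of j] down[of j] j assms(1)
    by auto
qed

section \<open>Drawing trees with prescribed directions\<close>

primrec rot :: "direction \<Rightarrow> direction" where
  "rot East = North"
| "rot North = West"
| "rot West = South"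
| "rot South = East"

text \<open>These are the eight symmetries of the square; the rotations among them suffice to send
  any given port to any given direction.\<close>

definition rigid :: "(direction \<Rightarrow> direction) \<Rightarrow> bool" where
  "rigid f \<longleftrightarrow> inj f \<and> (\<forall>x y. collinear_dirs (f x) (f y) \<longleftrightarrow> collinear_dirs x y)"

lemma rigid_id: "rigid id"
  by (simp add: rigid_def)

lemma rigid_rot: "rigid f \<Longrightarrow> rigid (rot \<circ> f)"
proof -
  have "inj rot" "collinear_dirs (rot x) (rot y) \<longleftrightarrow> collinear_dirs x y" for x y
    by (rule injI; rename_tac x y; case_tac x; case_tac y; simp)
       (cases x; cases y; simp add: collinear_dirs_def)
  then show "rigid f \<Longrightarrow> rigid (rot \<circ> f)" by (simp add: rigid_def inj_compose)
qed

lemma rigid_exists: "\<exists>f. rigid f \<and> f p = \<delta>"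
proof -
  note r = rigid_id rigid_rot[OF rigid_id] rigid_rot[OF rigid_rot[OF rigid_id]]
    rigid_rot[OF rigid_rot[OF rigid_rot[OF rigid_id]]]
  have "id p = \<delta> \<or> (rot \<circ> id) p = \<delta> \<or> (rot \<circ> (rot \<circ> id)) p = \<delta> \<or> (rot \<circ> (rot \<circ> (rot \<circ> id))) p = \<delta>"
    by (cases p; cases \<delta>; simp)
  then show ?thesis using r by metis
qed

lemma rigid_eq_iff: "rigid f \<Longrightarrow> f x = f y \<longleftrightarrow> x = y"
  by (auto simp: rigid_def inj_eq)

section \<open>Directions and segments as linear inequalities\<close>

definition towards :: "'a model \<Rightarrow> 'a \<Rightarrow> direction \<Rightarrow> 'a \<Rightarrow> bool" where
  "towards M u \<delta> v \<longleftrightarrow>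
     (\<exists>t>0. M v = (fst (M u) + t * fst (dir_vec \<delta>), snd (M u) + t * snd (dir_vec \<delta>)))"

lemma towards_unique: "towards M u \<delta> v \<Longrightarrow> towards M u \<epsilon> v \<Longrightarrow> \<delta> = \<epsilon>"
  by (cases \<delta>; cases \<epsilon>) (auto simp: towards_def)

lemma towards_horizontal: "towards M u \<delta> v \<Longrightarrow> horizontal M u v \<longleftrightarrow> collinear_dirs \<delta> East"
  by (cases \<delta>) (auto simp: towards_def horizontal_def collinear_dirs_def prod_eq_iff)

lemma towards_axis: "towards M u \<delta> v \<Longrightarrow> horizontal M u v \<or> vertical M u v"
  by (cases \<delta>) (auto simp: towards_def horizontal_def vertical_def)

lemma horizontal_sym: "horizontal M u v \<longleftrightarrow> horizontal M v u"
  by (auto simp: horizontal_def)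

text \<open>One coordinate is constant, so the parameter of the segment can be chosen from the other
  alone. Intersection questions thus become linear arithmetic.\<close>

lemma segment_box:
  assumes "horizontal M u v \<or> vertical M u v"
  shows "(x, y) \<in> segment M u v \<longleftrightarrow>
    real_of_int (min (fst (M u)) (fst (M v))) \<le> x \<and> x \<le> real_of_int (max (fst (M u)) (fst (M v))) \<and>
    real_of_int (min (snd (M u)) (snd (M v))) \<le> y \<and> y \<le> real_of_int (max (snd (M u)) (snd (M v)))"
proof -
  have *: "(\<exists>t\<ge>0. t \<le> 1 \<and> z = (1 - t) * a + t * b) \<longleftrightarrow> min a b \<le> z \<and> z \<le> max a b" for a b z :: real
    using closed_segment_eq_real_ivl[of a b] in_segment(1)[of z a b] by (auto simp: min_def max_def)
  have **: "(1 - t) * a + t * a = a" for a t :: real by (simp add: algebra_simps)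
  show ?thesis
    using assms *[of x "real_of_int (fst (M u))" "real_of_int (fst (M v))"]
      *[of y "real_of_int (snd (M u))" "real_of_int (snd (M v))"]
    unfolding segment_def in_segment grid_point_def horizontal_def vertical_def
    by (auto simp: of_int_min of_int_max **)
qed

lemma segment_commute: "segment M u v = segment M v u"
  by (simp add: segment_def closed_segment_commute)

text \<open>Doubling a drawing makes room for a new unit edge that ends at a point with an odd
  coordinate.\<close>

lemma unit_edge_meets_doubled_segment:
  assumes ax: "horizontal M a b \<or> vertical M a b"
    and M': "M' a = (2 * fst (M a), 2 * snd (M a))" "M' b = (2 * fst (M b), 2 * snd (M b))"
      "M' u = (2 * fst (M u), 2 * snd (M u))"
      "M' f = (2 * fst (M u) + fst (dir_vec \<delta>), 2 * snd (M u) + snd (dir_vec \<delta>))"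
    and q: "q \<in> segment M' a b" "q \<in> segment M' u f"
  shows "grid_point (M u) \<in> segment M a b"
proof -
  obtain x y where xy: "q = (x, y)" by (cases q)
  have ax': "horizontal M' a b \<or> vertical M' a b" using ax M' by (auto simp: horizontal_def vertical_def)
  have ax'': "horizontal M' u f \<or> vertical M' u f" using M' by (cases \<delta>) (auto simp: horizontal_def vertical_def)
  show ?thesis
    using q unfolding xy grid_point_def segment_box[OF ax'] segment_box[OF ax''] segment_box[OF ax] M' fst_conv snd_conv
    by (cases \<delta>) (simp_all, (linarith | auto simp: min_def max_def split: if_splits)+)
qed

text \<open>Doubling keeps the direction of the old edge, and two axis-parallel segments that leave
  u in different directions meet only at u.\<close>

lemma unit_edge_meets_towards:
  assumes t: "towards M u \<epsilon> b" "\<epsilon> \<noteq> \<delta>"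
    and M': "M' b = (2 * fst (M b), 2 * snd (M b))" "M' u = (2 * fst (M u), 2 * snd (M u))"
      "M' f = (2 * fst (M u) + fst (dir_vec \<delta>), 2 * snd (M u) + snd (dir_vec \<delta>))"
    and q: "q \<in> segment M' u b" "q \<in> segment M' u f"
  shows "q = grid_point (M' u)"
proof -
  obtain x y where xy: "q = (x, y)" by (cases q)
  have ax': "horizontal M' u b \<or> vertical M' u b" using towards_axis[OF t(1)] M' by (auto simp: horizontal_def vertical_def)
  have ax'': "horizontal M' u f \<or> vertical M' u f" using M' by (cases \<delta>) (auto simp: horizontal_def vertical_def)
  from t(1) obtain s where s: "s > 0" "M b = (fst (M u) + s * fst (dir_vec \<epsilon>), snd (M u) + s * snd (dir_vec \<epsilon>))"
    by (auto simp: towards_def)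
  show ?thesis
    using q s t(2) unfolding xy grid_point_def segment_box[OF ax'] segment_box[OF ax''] M' fst_conv snd_conv
    by (cases \<delta>; cases \<epsilon>) (simp_all add: min_def max_def)
qed

text \<open>The port \<open>\<phi> u v\<close> prescribes the direction of \<open>v\<close> at \<open>u\<close> up to a symmetry \<open>D u\<close> of the
  four directions.\<close>

definition realizes :: "'a graph \<Rightarrow> ('a \<Rightarrow> 'a \<Rightarrow> direction) \<Rightarrow> 'a set \<Rightarrow> 'a model \<Rightarrow>
    ('a \<Rightarrow> direction \<Rightarrow> direction) \<Rightarrow> bool" where
  "realizes G \<phi> S M D \<longleftrightarrow> inj_on M S \<and> (\<forall>v\<in>S. rigid (D v)) \<and>
     (\<forall>u\<in>S. \<forall>v\<in>S. {u, v} \<in> edges G \<longrightarrow> towards M u (D u (\<phi> u v)) v) \<and>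
     (\<forall>u\<in>S. \<forall>v\<in>S. \<forall>u'\<in>S. \<forall>v'\<in>S. {u, v} \<in> edges G \<longrightarrow> {u', v'} \<in> edges G \<longrightarrow> {u, v} \<noteq> {u', v'} \<longrightarrow>
        segment M u v \<inter> segment M u' v' \<subseteq> grid_point ` M ` ({u, v} \<inter> {u', v'}))"

lemma scaled_segment:
  assumes "horizontal M a b \<or> vertical M a b"
    "M' a = (2 * fst (M a), 2 * snd (M a))" "M' b = (2 * fst (M b), 2 * snd (M b))"
  shows "(x, y) \<in> segment M' a b \<longleftrightarrow> (x / 2, y / 2) \<in> segment M a b"
proof -
  have ax': "horizontal M' a b \<or> vertical M' a b" using assms by (auto simp: horizontal_def vertical_def)
  show ?thesis unfolding segment_box[OF ax'] segment_box[OF assms(1)] assms fst_conv snd_conv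
    by (auto simp: min_def max_def)
qed

text \<open>Since S is connected, u is the only neighbour of f in S. So a single unit edge is added
  to the doubled drawing, in the direction prescribed at u.\<close>

lemma realizes_extend:
  assumes tree: "tree G" and inj: "\<And>v. v \<in> verts G \<Longrightarrow> inj_on (\<phi> v) (nbrs G v)"
    and S: "S \<subseteq> verts G" "\<And>x y. x \<in> S \<Longrightarrow> y \<in> S \<Longrightarrow> reach G S x y"
    and u: "u \<in> S" "f \<notin> S" "{u, f} \<in> edges G"
    and R: "realizes G \<phi> S M D"
  shows "\<exists>M' D'. realizes G \<phi> (insert f S) M' D'"
proof -
  define \<delta> where "\<delta> = D u (\<phi> u f)"
  have fu: "{f, u} \<in> edges G" using u by (simp add: insert_commute)
  \<comment> \<open>The frame at f is turned so that the port of u points back: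
    \<open>rot (rot \<delta>)\<close> is the direction opposite to \<delta>.\<close>
  obtain E where E: "rigid E" "E (\<phi> f u) = rot (rot \<delta>)" using rigid_exists by blast
  define D' where "D' = D(f := E)"
  define M' where "M' = (\<lambda>z. if z = f then (2 * fst (M u) + fst (dir_vec \<delta>), 2 * snd (M u) + snd (dir_vec \<delta>))
      else (2 * fst (M z), 2 * snd (M z)))"
  have M'S: "M' z = (2 * fst (M z), 2 * snd (M z))" if "z \<in> S" for z using that u by (auto simp: M'_def)
  have M'f: "M' f = (2 * fst (M u) + fst (dir_vec \<delta>), 2 * snd (M u) + snd (dir_vec \<delta>))"
    by (simp add: M'_def)
  have injM: "inj_on M S" and dirs: "\<And>a b. a \<in> S \<Longrightarrow> b \<in> S \<Longrightarrow> {a, b} \<in> edges G \<Longrightarrow> towards M a (D a (\<phi> a b)) b"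
    and segs: "\<And>a b a' b'. a \<in> S \<Longrightarrow> b \<in> S \<Longrightarrow> a' \<in> S \<Longrightarrow> b' \<in> S \<Longrightarrow> {a, b} \<in> edges G \<Longrightarrow> {a', b'} \<in> edges G \<Longrightarrow>
      {a, b} \<noteq> {a', b'} \<Longrightarrow> segment M a b \<inter> segment M a' b' \<subseteq> grid_point ` M ` ({a, b} \<inter> {a', b'})"
    using R unfolding realizes_def by blast+
  have nbr_f: "b = u" if "b \<in> S" "{f, b} \<in> edges G" for b
    using tree_nbr_unique[OF tree u(2) S(1) u(1) S(2)[OF that(1) u(1)] that(2) fu] .
  have loop: "{a, a} \<notin> edges G" for a using edge_verts[OF tree, of a a] by auto
  have new_edge: "a \<in> S \<and> b \<in> S \<or> a = f \<and> b = u \<or> a = u \<and> b = f"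
    if h: "a \<in> insert f S" "b \<in> insert f S" "{a, b} \<in> edges G" for a b
  proof (cases "a = f \<or> b = f")
    case True
    then show ?thesis
    proof
      assume "a = f"
      then have "b \<in> S" using h loop[of f] by auto
      then show ?thesis using nbr_f[of b] h \<open>a = f\<close> by simp
    next
      assume "b = f"
      then have "a \<in> S" using h loop[of f] by auto
      moreover have "{f, a} \<in> edges G" using h \<open>b = f\<close> by (simp add: insert_commute)
      ultimately show ?thesis using nbr_f[of a] \<open>b = f\<close> by simp
    qed
  qed (use h in simp)
  have gp_inj: "grid_point p = grid_point q \<Longrightarrow> p = q" for p q by (auto simp: grid_point_def prod_eq_iff)

  have M'uf: "towards M' u \<delta> f" "towards M' f (rot (rot \<delta>)) u"
    using M'S[OF u(1)] M'f by (cases \<delta>; auto simp: towards_def intro!: exI[of _ 1])+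

  \<comment> \<open>If u were drawn on an edge that does not end at u, connectivity of S would give
    an edge from u to some u', and these two edges would violate the segment condition.\<close>
  have on_u: "u \<in> {a, b}"
    if ab: "a \<in> S" "b \<in> S" "{a, b} \<in> edges G" and g: "grid_point (M u) \<in> segment M a b" for a b
  proof (rule ccontr)
    assume n: "u \<notin> {a, b}"
    have "reach G S u a" using S(2) u ab by auto
    then have "u = a \<or> (\<exists>u'. u' \<in> S \<and> {u, u'} \<in> edges G)"
      unfolding reach_def by (rule converse_rtranclpE) auto
    then obtain u' where u': "u' \<in> S" "{u, u'} \<in> edges G" using n by auto
    have "{a, b} \<noteq> {u, u'}" using n by auto
    then have "grid_point (M u) \<in> grid_point ` M ` ({a, b} \<inter> {u, u'})"
      using segs[OF ab(1,2) u(1) u'(1) ab(3) u'(2)] g by (auto simp: segment_def)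
    then obtain w where w: "w \<in> {a, b}" "grid_point (M u) = grid_point (M w)" by blast
    from w(2) have "M u = M w" by (rule gp_inj)
    then have "u = w" using u(1) ab w(1) inj_onD[OF injM] by blast
    then show False using w n by auto
  qed
  \<comment> \<open>A common point forces the old edge to end at u; there the injective ports give
    it a direction other than \<delta>.\<close>
  have new_seg: "q = grid_point (M' u) \<and> u \<in> {a, b}"
    if ab: "a \<in> S" "b \<in> S" "{a, b} \<in> edges G" and q: "q \<in> segment M' a b" "q \<in> segment M' u f" for a b q
  proof -
    have "grid_point (M u) \<in> segment M a b"
      using unit_edge_meets_doubled_segment[OF towards_axis[OF dirs[OF ab]] M'S[OF ab(1)] M'S[OF ab(2)]
          M'S[OF u(1)] M'f q] .
    then have uab: "u \<in> {a, b}" using on_u ab by blast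
    then obtain c where c: "c \<in> S" "{u, c} \<in> edges G" "q \<in> segment M' u c"
      using ab q by (auto simp: insert_commute segment_commute)
    have "c \<noteq> f" using c u by auto
    have "f \<in> nbrs G u" "c \<in> nbrs G u" using u c by (auto simp: nbrs_def)
    then have "\<phi> u c \<noteq> \<phi> u f"
      using inj[of u] S(1) u(1) \<open>c \<noteq> f\<close> by (auto simp: inj_on_def)
    then have "D u (\<phi> u c) \<noteq> \<delta>"
      using R u(1) unfolding realizes_def \<delta>_def by (simp add: rigid_eq_iff)
    then show ?thesis
      using unit_edge_meets_towards[OF dirs[OF u(1) c(1,2)] _ M'S[OF c(1)] M'S[OF u(1)] M'f c(3) q(2)] uab
      by blast
  qed
  have new_sub: "segment M' a b \<inter> segment M' u f \<subseteq> grid_point ` M' ` ({a, b} \<inter> {u, f})"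
    if ab: "a \<in> S" "b \<in> S" "{a, b} \<in> edges G" for a b
  proof
    fix q assume "q \<in> segment M' a b \<inter> segment M' u f"
    then have q: "q = grid_point (M' u)" "u \<in> {a, b} \<inter> {u, f}" using new_seg[OF ab, of q] by auto
    show "q \<in> grid_point ` M' ` ({a, b} \<inter> {u, f})"
      unfolding q(1) by (intro imageI q(2))
  qed
  have old_seg: "segment M' a b \<inter> segment M' a' b' \<subseteq> grid_point ` M' ` ({a, b} \<inter> {a', b'})"
    if h: "a \<in> S" "b \<in> S" "a' \<in> S" "b' \<in> S" "{a, b} \<in> edges G" "{a', b'} \<in> edges G" "{a, b} \<noteq> {a', b'}"
    for a b a' b'
  proof
    fix q assume q: "q \<in> segment M' a b \<inter> segment M' a' b'"
    obtain x y where xy: "q = (x, y)" by (cases q)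
    have "(x / 2, y / 2) \<in> segment M a b" "(x / 2, y / 2) \<in> segment M a' b'"
      using q scaled_segment[OF towards_axis[OF dirs[OF h(1,2,5)]] M'S[OF h(1)] M'S[OF h(2)], of x y]
        scaled_segment[OF towards_axis[OF dirs[OF h(3,4,6)]] M'S[OF h(3)] M'S[OF h(4)], of x y]
      unfolding xy by simp_all
    then have "(x / 2, y / 2) \<in> grid_point ` M ` ({a, b} \<inter> {a', b'})"
      using segs[OF h] by (meson IntI subsetD)
    then obtain w where w: "(x / 2, y / 2) = grid_point (M w)" "w \<in> {a, b} \<inter> {a', b'}"
      unfolding image_image by (rule imageE)
    have "w \<in> S" using w(2) h by auto
    then have "q = grid_point (M' w)" using M'S[of w] w(1) xy by (simp add: grid_point_def)
    then show "q \<in> grid_point ` M' ` ({a, b} \<inter> {a', b'})" using w by auto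
  qed
  have "realizes G \<phi> (insert f S) M' D'"
    unfolding realizes_def
  proof (intro conjI ballI impI)
    \<comment> \<open>The new point has an odd coordinate, while all old coordinates are doubled and
      hence even.\<close>
    have "M' f \<noteq> M' z \<and> M' z \<noteq> M' f" if "z \<in> S" for z
      using M'S[OF that] M'f by (cases \<delta>) (auto, presburger+)
    moreover have "inj_on M' S"
      using injM M'S by (auto simp: inj_on_def prod_eq_iff)
    ultimately show "inj_on M' (insert f S)" unfolding inj_on_def by blast
  next
    fix v assume "v \<in> insert f S"
    then show "rigid (D' v)" using E R by (auto simp: D'_def realizes_def)
  next
    fix a b assume h: "a \<in> insert f S" "b \<in> insert f S" "{a, b} \<in> edges G"
    consider "a \<in> S" "b \<in> S" | "a = f" "b = u" | "a = u" "b = f"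
      using new_edge[OF h] by blast
    then show "towards M' a (D' a (\<phi> a b)) b"
    proof cases
      case 1
      then obtain t where t: "t > 0" "M b = (fst (M a) + t * fst (dir_vec (D a (\<phi> a b))), snd (M a) + t * snd (dir_vec (D a (\<phi> a b))))"
        using dirs h by (auto simp: towards_def)
      have "D' a = D a" using 1 u by (auto simp: D'_def)
      then show ?thesis
        unfolding towards_def using t 1 by (intro exI[of _ "2 * t"]) (simp add: M'S algebra_simps)
    next
      case 2
      then show ?thesis using M'uf E by (simp add: D'_def)
    next
      case 3
      then show ?thesis using M'uf u by (auto simp: D'_def \<delta>_def)
    qed
  next
    fix a b a' b'
    assume h: "a \<in> insert f S" "b \<in> insert f S" "a' \<in> insert f S" "b' \<in> insert f S"
      "{a, b} \<in> edges G" "{a', b'} \<in> edges G" "{a, b} \<noteq> {a', b'}"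
    have cs: "c \<in> S \<and> d \<in> S \<or> {c, d} = {u, f} \<and> segment M' c d = segment M' u f"
      if "c \<in> insert f S" "d \<in> insert f S" "{c, d} \<in> edges G" for c d
      using new_edge[OF that] segment_commute[of M' u f] by blast
    from cs[OF h(1,2,5)]
    show "segment M' a b \<inter> segment M' a' b' \<subseteq> grid_point ` M' ` ({a, b} \<inter> {a', b'})"
    proof (elim disjE conjE)
      assume ab: "a \<in> S" "b \<in> S"
      from cs[OF h(3,4,6)] show ?thesis
      proof (elim disjE conjE)
        assume "a' \<in> S" "b' \<in> S"
        then show ?thesis using old_seg[OF ab _ _ h(5-7)] by simp
      next
        assume eq: "{a', b'} = {u, f}" "segment M' a' b' = segment M' u f"
        show ?thesis unfolding eq by (rule new_sub[OF ab h(5)])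
      qed
    next
      assume eq: "{a, b} = {u, f}" "segment M' a b = segment M' u f"
      from cs[OF h(3,4,6)] show ?thesis
      proof (elim disjE conjE)
        assume "a' \<in> S" "b' \<in> S"
        then have "segment M' a' b' \<inter> segment M' u f \<subseteq> grid_point ` M' ` ({a', b'} \<inter> {u, f})"
          using new_sub[OF _ _ h(6)] by simp
        then show ?thesis unfolding eq by (simp only: Int_commute)
      next
        assume "{a', b'} = {u, f}"
        then show ?thesis using eq h(7) by simp
      qed
    qed
  qed
  then show ?thesis by blast
qed

text \<open>Grow a connected drawn set by one vertex at a time; a walk to a missing vertex yields an
  edge that leaves the set.\<close>

lemma exists_realization:
  assumes tree: "tree G" and inj: "\<And>v. v \<in> verts G \<Longrightarrow> inj_on (\<phi> v) (nbrs G v)"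
  shows "\<exists>M D. realizes G \<phi> (verts G) M D"
proof -
  have fin: "finite (verts G)" using tree by (rule tree_finite)
  have "\<exists>S M D. card S = n \<and> S \<subseteq> verts G \<and> (\<forall>x\<in>S. \<forall>y\<in>S. reach G S x y) \<and> realizes G \<phi> S M D"
    if "1 \<le> n" "n \<le> card (verts G)" for n
    using that
  proof (induction n rule: dec_induct)
    case base
    obtain r where r: "r \<in> verts G" using tree by (auto simp: tree_def)
    have "realizes G \<phi> {r} (\<lambda>_. (0, 0)) (\<lambda>_. id)"
      using edge_verts[OF tree, of r r] by (auto simp: realizes_def rigid_id)
    then show ?case using r by (intro exI[of _ "{r}"]) auto
  next
    case (step n)
    then obtain S M D where IH: "card S = n" "S \<subseteq> verts G" "\<And>x y. x \<in> S \<Longrightarrow> y \<in> S \<Longrightarrow> reach G S x y"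
      "realizes G \<phi> S M D" by auto
    have finS: "finite S" using IH fin finite_subset by blast
    obtain x where x: "x \<in> S" using IH step by fastforce
    obtain y where y: "y \<in> verts G" "y \<notin> S" using IH step by (metis Suc_n_not_le_n subsetI subset_antisym)
    have "reach G (verts G) x y" using tree_reach[OF tree] x y IH by auto
    then have "y \<in> S \<or> (\<exists>u f. u \<in> S \<and> f \<notin> S \<and> {u, f} \<in> edges G)"
      unfolding reach_def by (induction rule: rtranclp_induct) (use x in auto)
    then obtain u f where uf: "u \<in> S" "f \<notin> S" "{u, f} \<in> edges G" using y by blast
    have ru: "reach G (insert f S) z u" if "z \<in> insert f S" for z
      using that uf reach_mono[OF IH(3), of z u "insert f S"] reach_step[of f u G "insert f S"]
      by (auto simp: insert_commute)
    have "\<exists>M' D'. realizes G \<phi> (insert f S) M' D'"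
      by (rule realizes_extend[OF tree inj IH(2,3) uf IH(4)]) auto
    moreover have "\<forall>x\<in>insert f S. \<forall>y\<in>insert f S. reach G (insert f S) x y"
      using ru reach_sym reach_trans by metis
    moreover have "card (insert f S) = Suc n" "insert f S \<subseteq> verts G"
      using IH uf finS edge_verts[OF tree uf(3)] by auto
    ultimately show ?case by blast
  qed
  moreover have "1 \<le> card (verts G)" using tree fin by (auto simp: tree_def Suc_le_eq card_gt_0_iff)
  ultimately show ?thesis using card_subset_eq[OF fin] by (metis order_refl)
qed

lemma realizes_s_model:
  assumes "tree G" "realizes G \<phi> (verts G) M D"
  shows "s_model G M"
  using assms(2) edge_verts[OF assms(1)] unfolding s_model_def realizes_def
  by (meson towards_axis)

section \<open>Collinear largest branches\<close>

text \<open>The frame \<open>D v\<close> preserves collinearity, so turns can be read off the ports,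
  however the drawing is oriented at v.\<close>

lemma realizes_turn_iff:
  assumes "realizes G \<phi> S M D" "v \<in> S" "a \<in> S" "b \<in> S" "{v, a} \<in> edges G" "{v, b} \<in> edges G"
  shows "horizontal M a v \<noteq> horizontal M v b \<longleftrightarrow> \<not> collinear_dirs (\<phi> v a) (\<phi> v b)"
proof -
  have t: "towards M v (D v (\<phi> v a)) a" "towards M v (D v (\<phi> v b)) b" and r: "rigid (D v)"
    using assms by (auto simp: realizes_def)
  have "collinear_dirs x East \<noteq> collinear_dirs y East \<longleftrightarrow> \<not> collinear_dirs x y" for x y
    by (cases x; cases y) (auto simp: collinear_dirs_def)
  then show ?thesis
    using r by (simp add: towards_horizontal[OF t(1)] towards_horizontal[OF t(2)] horizontal_sym[of M a v] rigid_def)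
qed

lemma exists_max_nat:
  fixes s :: "'a \<Rightarrow> nat"
  assumes "finite N" "N \<noteq> {}"
  obtains p where "p \<in> N" "\<And>x. x \<in> N \<Longrightarrow> s x \<le> s p"
proof -
  have "Max (s ` N) \<in> s ` N" using assms by simp
  then obtain p where "p \<in> N" "s p = Max (s ` N)" by auto
  then show ?thesis using that[of p] assms(1) by simp
qed

text \<open>A largest and a second largest element p and q get the opposite ports East and West, the
  at most two others North and South. If a and b are not collinear, one of them lies outside {p, q},
  and p or q serves as c.\<close>

lemma exists_ports:
  fixes s :: "'a \<Rightarrow> nat"
  assumes "finite N" "card N \<le> 4"
  shows "\<exists>\<phi>. inj_on \<phi> N \<and> (\<forall>a\<in>N. \<forall>b\<in>N. a \<noteq> b \<longrightarrow> \<not> collinear_dirs (\<phi> a) (\<phi> b) \<longrightarrow>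
    (\<exists>c\<in>N - {a, b}. min (s a) (s b) \<le> s c))"
proof (cases "card N \<le> 1")
  case True
  then have "a = b" if "a \<in> N" "b \<in> N" for a b
    using that assms(1) by (metis card_le_Suc0_iff_eq One_nat_def)
  then show ?thesis by (intro exI[of _ "\<lambda>_. East"]) (auto simp: inj_on_def)
next
  case False
  then have "N \<noteq> {}" by auto
  then obtain p where p: "p \<in> N" "\<And>x. x \<in> N \<Longrightarrow> s x \<le> s p"
    using exists_max_nat[OF assms(1)] by metis
  have "N - {p} \<noteq> {}" using False p card_mono[of "{p}" N] by fastforce
  then obtain q where q: "q \<in> N - {p}" "\<And>x. x \<in> N - {p} \<Longrightarrow> s x \<le> s q"
    using exists_max_nat[of "N - {p}" s] assms(1) by auto
  have "card (N - {p, q}) \<le> card {North, South}"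
    using assms p q by (subst card_Diff_subset) auto
  then obtain g where g: "g ` (N - {p, q}) \<subseteq> {North, South}" "inj_on g (N - {p, q})"
    using card_le_inj[of "N - {p, q}" "{North, South}"] assms(1) by auto
  define \<phi> where "\<phi> = (\<lambda>x. if x = p then East else if x = q then West else g x)"
  have gx: "g x \<noteq> East" "g x \<noteq> West" if "x \<in> N" "x \<notin> {p, q}" for x
  proof -
    have "g x \<in> {North, South}" using g(1) that by blast
    then show "g x \<noteq> East" "g x \<noteq> West" by auto
  qed
  have "inj_on \<phi> N"
  proof (rule inj_onI)
    fix x y assume xy: "x \<in> N" "y \<in> N" "\<phi> x = \<phi> y"
    show "x = y"
    proof (cases "x \<in> {p, q} \<or> y \<in> {p, q}")
      case True
      then show ?thesis using xy gx[of x] gx[of y] unfolding \<phi>_def by (auto split: if_splits)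
    next
      case False
      then show ?thesis using xy inj_onD[OF g(2), of x y] by (simp add: \<phi>_def)
    qed
  qed
  moreover have "\<exists>c\<in>N - {a, b}. min (s a) (s b) \<le> s c"
    if "a \<in> N" "b \<in> N" "a \<noteq> b" "\<not> collinear_dirs (\<phi> a) (\<phi> b)" for a b
  proof -
    have "a \<notin> {p, q} \<or> b \<notin> {p, q}"
      using that by (auto simp: \<phi>_def collinear_dirs_def)
    then show ?thesis
    proof
      assume a: "a \<notin> {p, q}"
      show ?thesis
        using a that p q by (intro bexI[of _ "if b = p then q else p"]) (auto simp: min_le_iff_disj)
    next
      assume b: "b \<notin> {p, q}"
      show ?thesis
        using b that p q by (intro bexI[of _ "if a = p then q else p"]) (auto simp: min_le_iff_disj)
    qed
  qed
  ultimately show ?thesis by blast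
qed

lemma many_bends_many_verts:
  assumes tree: "tree G" and R: "realizes G \<phi> (verts G) M D"
    and ports: "\<And>v a b. {v, a} \<in> edges G \<Longrightarrow> {v, b} \<in> edges G \<Longrightarrow> a \<noteq> b \<Longrightarrow>
      \<not> collinear_dirs (\<phi> v a) (\<phi> v b) \<Longrightarrow>
      \<exists>c. {v, c} \<in> edges G \<and> c \<noteq> a \<and> c \<noteq> b \<and>
        min (card (branch G v a)) (card (branch G v b)) \<le> card (branch G v c)"
    and xs: "gpath G u xs w" "length xs \<ge> 2"
  obtains a b where "a + b = bends M xs" "2 ^ (a + 1) + 2 ^ (b + 1) \<le> card (verts G) + 2"
proof -
  define l where "l = length xs - 1"
  \<comment> \<open>\<open>F i\<close> is the size of the part behind the i-th edge,
    \<open>B i\<close> that of the part ahead; an index in \<open>A\<close> is the edge just before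
    a bend.\<close>
  define F where "F i = card (branch G (xs ! Suc i) (xs ! i))" for i
  define B where "B i = card (branch G (xs ! i) (xs ! Suc i))" for i
  define A where "A = {i. i + 2 < length xs \<and>
     horizontal M (xs ! i) (xs ! (i + 1)) \<noteq> horizontal M (xs ! (i + 1)) (xs ! (i + 2))}"
  have e: "{xs ! i, xs ! Suc i} \<in> edges G" "{xs ! Suc i, xs ! i} \<in> edges G" if "i < l" for i
    using xs that successively_nth[of "\<lambda>x y. {x, y} \<in> edges G" xs i]
    by (auto simp: gpath_def l_def insert_commute)
  have d: "xs ! i \<noteq> xs ! Suc (Suc i)" if "Suc i < l" for i
    using xs that nth_eq_iff_index_eq[of xs i "Suc (Suc i)"] by (auto simp: gpath_def l_def)
  have step: "F i < F (Suc i)" "B (Suc i) < B i" if "Suc i < l" for i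
    using card_branch_ge[OF tree e(2)[of i] e(1)[of "Suc i"]]
      card_branch_ge[OF tree e(1)[of "Suc i"] e(2)[of i]] d[of i] that
    by (auto simp: F_def B_def)
  have turn: "F i + min (F i) (B (Suc i)) + 1 \<le> F (Suc i) \<and> B (Suc i) + min (F i) (B (Suc i)) + 1 \<le> B i"
    if "i \<in> A" for i
  proof -
    have i: "Suc i < l" and h: "horizontal M (xs ! i) (xs ! Suc i) \<noteq> horizontal M (xs ! Suc i) (xs ! Suc (Suc i))"
      using that by (auto simp: A_def l_def)
    note ee = e(2)[of i] e(1)[of "Suc i"]
    have "\<not> collinear_dirs (\<phi> (xs ! Suc i) (xs ! i)) (\<phi> (xs ! Suc i) (xs ! Suc (Suc i)))"
      using realizes_turn_iff[OF R _ _ _ ee] edge_verts[OF tree ee(1)] edge_verts[OF tree ee(2)] h i by auto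
    \<comment> \<open>The third neighbour c hangs off the path, so its branch counts towards both
      \<open>F (Suc i)\<close> and \<open>B i\<close>.\<close>
    then obtain c where c: "{xs ! Suc i, c} \<in> edges G" "c \<noteq> xs ! i" "c \<noteq> xs ! Suc (Suc i)"
      "min (F i) (B (Suc i)) \<le> card (branch G (xs ! Suc i) c)"
      using ports[OF ee] d[OF i] i by (auto simp: F_def B_def)
    show ?thesis
      using card_branch_ge2[OF tree ee c(1)] card_branch_ge2[OF tree ee(2,1) c(1)] c d[OF i] i
      by (auto simp: F_def B_def)
  qed
  obtain j a b where jab: "j < l" "a + b = card A" "2 ^ (a + 1) \<le> F j + 1" "2 ^ (b + 1) \<le> B j + 1"
  proof (rule turns_bound[of l A F B])
    show "1 \<le> l" "A \<subseteq> {i. Suc i < l}" using xs by (auto simp: l_def A_def)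
    show "1 \<le> F i \<and> 1 \<le> B i" if "i < l" for i
      using card_branch_pos[OF tree e(1)[OF that]] card_branch_pos[OF tree e(2)[OF that]]
      by (simp add: F_def B_def)
    show "F i \<le> F (Suc i) \<and> B (Suc i) \<le> B i" if "Suc i < l" for i using step[OF that] by simp
  qed (use turn in auto)
  \<comment> \<open>The two sides of edge j are disjoint, so both powers of two are counted at
    once.\<close>
  have "F j + B j \<le> card (verts G)"
    using card_branch_opposite[OF tree e(2)[OF jab(1)]] by (simp add: F_def B_def)
  then show ?thesis using that[of a b] jab by (simp add: A_def bends_def)
qed

section \<open>From the bend number to a path with many bends\<close>

lemma Sup_nat_le:
  fixes n :: nat
  assumes "\<And>x. x \<in> X \<Longrightarrow> x \<le> n"
  shows "Sup X \<le> n"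
  using assms cSup_least[of X n] by (cases "X = {}") (auto simp: Sup_nat_def)

text \<open>The bend number is a minimum over all models, so this model has maximal bend count at
  least k. As k is positive, this is not the default \<open>Sup {} = 0\<close>, and some pair of
  leaves witnesses it.\<close>

lemma exists_bends_ge:
  assumes "s_model G M" "k \<ge> 1" "bend_number G = k"
  shows "\<exists>u w. leaf G u \<and> leaf G w \<and> path_bends G M u w \<ge> k"
proof -
  let ?X = "{path_bends G M u w | u w. leaf G u \<and> leaf G w}"
  have "k \<le> Sup ?X"
    using assms cInf_lower[of "model_bends G M" "model_bends G ` {M. s_model G M}"]
    by (auto simp: bend_number_def model_bends_def)
  show ?thesis
  proof (rule ccontr)
    assume "\<not> ?thesis"
    then have "x \<le> k - 1" if "x \<in> ?X" for x using that assms(2) by fastforce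
    then have "Sup ?X \<le> k - 1" by (rule Sup_nat_le)
    then show False using \<open>k \<le> Sup ?X\<close> assms(2) by linarith
  qed
qed

text \<open>The ports rank the neighbours of each vertex by branch size. The path found may have
  more than k bends, hence only \<open>a + b \<ge> k\<close>.\<close>

lemma exists_model_bends:
  assumes tree: "tree G" and deg: "\<forall>v\<in>verts G. deg G v \<le> 4" and k: "bend_number G = k" "k \<ge> 1"
  obtains a b where "a + b \<ge> k" "2 ^ (a + 1) + 2 ^ (b + 1) \<le> card (verts G) + 2"
proof -
  have "\<exists>f. inj_on f (nbrs G v) \<and> (\<forall>a\<in>nbrs G v. \<forall>b\<in>nbrs G v. a \<noteq> b \<longrightarrow> \<not> collinear_dirs (f a) (f b) \<longrightarrow>
    (\<exists>c\<in>nbrs G v - {a, b}. min (card (branch G v a)) (card (branch G v b)) \<le> card (branch G v c)))"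
    if "v \<in> verts G" for v
  proof (rule exists_ports)
    have "nbrs G v \<subseteq> verts G" using edge_verts[OF tree] by (auto simp: nbrs_def)
    then show "finite (nbrs G v)" using tree_finite[OF tree] finite_subset by blast
    show "card (nbrs G v) \<le> 4" using deg that by (simp add: deg_def)
  qed
  then obtain \<phi> where \<phi>: "\<And>v. v \<in> verts G \<Longrightarrow> inj_on (\<phi> v) (nbrs G v)"
    "\<And>v a b. v \<in> verts G \<Longrightarrow> a \<in> nbrs G v \<Longrightarrow> b \<in> nbrs G v \<Longrightarrow> a \<noteq> b \<Longrightarrow> \<not> collinear_dirs (\<phi> v a) (\<phi> v b) \<Longrightarrow>
    (\<exists>c\<in>nbrs G v - {a, b}. min (card (branch G v a)) (card (branch G v b)) \<le> card (branch G v c))"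
    by metis
  obtain M D where R: "realizes G \<phi> (verts G) M D" using exists_realization[OF tree \<phi>(1)] by blast
  obtain u w where uw: "leaf G u" "leaf G w" "path_bends G M u w \<ge> k"
    using exists_bends_ge[OF realizes_s_model[OF tree R] k(2,1)] by blast
  define xs where "xs = the_path G u w"
  have xs: "gpath G u xs w" unfolding xs_def using uw by (intro tree_gpath[OF tree]) (auto simp: leaf_def)
  have "bends M xs \<ge> 1" using uw k by (simp add: path_bends_def xs_def)
  then have "{i. i + 2 < length xs \<and>
     horizontal M (xs ! i) (xs ! (i + 1)) \<noteq> horizontal M (xs ! (i + 1)) (xs ! (i + 2))} \<noteq> {}"
    unfolding bends_def by (metis card.empty not_one_le_zero)
  then have len: "length xs \<ge> 2" by auto
  obtain a b where "a + b = bends M xs" "2 ^ (a + 1) + 2 ^ (b + 1) \<le> card (verts G) + 2"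
  proof (rule many_bends_many_verts[OF tree R _ xs len])
    fix v a b assume h: "{v, a} \<in> edges G" "{v, b} \<in> edges G" "a \<noteq> b" "\<not> collinear_dirs (\<phi> v a) (\<phi> v b)"
    show "\<exists>c. {v, c} \<in> edges G \<and> c \<noteq> a \<and> c \<noteq> b \<and>
        min (card (branch G v a)) (card (branch G v b)) \<le> card (branch G v c)"
      using \<phi>(2)[of v a b] h edge_verts[OF tree h(1)] by (auto simp: nbrs_def)
  qed
  moreover have "bends M xs \<ge> k" using uw(3) by (simp add: path_bends_def xs_def)
  ultimately show ?thesis using that[of a b] by simp
qed

section \<open>The geometric sums behind the size of \<open>Tk k\<close>\<close>

lemma sum_power2_Icc: "(\<Sum>i=1..n. 2 ^ i) + 2 = (2::nat) ^ (n + 1)"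
  by (induction n) auto

lemma sum_min_le:
  assumes "a + b \<ge> k"
  shows "(\<Sum>i=1..k. 2 ^ (min (i - 1) (k - i) + 1)) + 4 \<le> (2::nat) ^ (a + 1) + 2 ^ (b + 1)"
proof -
  \<comment> \<open>\<open>a + b\<close> may exceed k, so both parts are shortened to add up to k
    exactly; the sum then splits into two geometric series.\<close>
  define a' where "a' = min a k"
  define b' where "b' = k - a'"
  have ab: "a' \<le> a" "b' \<le> b" "k = a' + b'" using assms by (auto simp: a'_def b'_def)
  have "(\<Sum>i=1..k. (2::nat) ^ (min (i - 1) (k - i) + 1)) =
      (\<Sum>i=1..a'. 2 ^ (min (i - 1) (k - i) + 1)) + (\<Sum>i=a'+1..k. 2 ^ (min (i - 1) (k - i) + 1))"
    using sum.ub_add_nat[of 1 a' "\<lambda>i. (2::nat) ^ (min (i - 1) (k - i) + 1)" b'] ab by simp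
  also have "\<dots> \<le> (\<Sum>i=1..a'. 2 ^ i) + (\<Sum>i=a'+1..k. 2 ^ (k + 1 - i))"
    by (intro add_mono sum_mono power_increasing) auto
  \<comment> \<open>Reversing the order by i to k + 1 - i turns the second half into the same kind
    of series.\<close>
  also have "(\<Sum>i=a'+1..k. (2::nat) ^ (k + 1 - i)) = (\<Sum>i=1..b'. 2 ^ i)"
    using ab by (intro sum.reindex_bij_witness[of _ "\<lambda>i. k + 1 - i" "\<lambda>i. k + 1 - i"]) auto
  finally have "(\<Sum>i=1..k. (2::nat) ^ (min (i - 1) (k - i) + 1)) + 4 \<le> 2 ^ (a' + 1) + 2 ^ (b' + 1)"
    using sum_power2_Icc[of a'] sum_power2_Icc[of b'] by linarith
  also have "\<dots> \<le> 2 ^ (a + 1) + 2 ^ (b + 1)"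
    using ab by (intro add_mono power_increasing) auto
  finally show ?thesis .
qed

section \<open>Complete binary trees\<close>

text \<open>The complete binary tree of depth d in heap order: the root is 1, the children of n are
  2 n and 2 n + 1, and level i is the range from \<open>2 ^ i\<close> to
  \<open>2 ^ (i + 1) - 1\<close>.\<close>

definition heap :: "nat \<Rightarrow> nat graph" where
  "heap d = \<lparr>verts = {1..<2 ^ (d + 1)}, edges = {{n, n div 2} | n. 2 \<le> n \<and> n < 2 ^ (d + 1)}\<rparr>"

lemma verts_heap: "verts (heap d) = {1..<2 ^ (d + 1)}"
  by (simp add: heap_def)

lemma heap_edge: "{x, y} \<in> edges (heap d) \<longleftrightarrow>
    2 \<le> x \<and> x < 2 ^ (d + 1) \<and> y = x div 2 \<or> 2 \<le> y \<and> y < 2 ^ (d + 1) \<and> x = y div 2"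
  by (auto simp: heap_def doubleton_eq_iff)

lemma tree_heap: "tree (heap d)"
proof -
  have "simple_graph (heap d)"
    unfolding simple_graph_def
  proof (intro conjI ballI)
    fix e assume "e \<in> edges (heap d)"
    then obtain n where n: "e = {n, n div 2}" "2 \<le> n" "n < 2 ^ (d + 1)" by (auto simp: heap_def)
    then have "n div 2 \<noteq> n" "1 \<le> n div 2" by auto
    then show "e \<subseteq> verts (heap d)" "card e = 2" using n by (auto simp: verts_heap)
  qed (simp add: verts_heap)
  moreover have "verts (heap d) \<noteq> {}"
    using one_less_power[of "2::nat" "d + 1"] by (simp add: verts_heap)
  moreover have "\<exists>xs. gpath (heap d) u xs w" if "u \<in> verts (heap d)" "w \<in> verts (heap d)" for u w
  proof -
    have "reach (heap d) (verts (heap d)) n 1" if "n \<in> verts (heap d)" for n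
      using that
    proof (induction n rule: less_induct)
      case (less n)
      show ?case
      proof (cases "n = 1")
        case False
        then have n: "2 \<le> n" "n < 2 ^ (d + 1)" using less.prems by (auto simp: verts_heap)
        then have "n div 2 \<in> verts (heap d)" by (auto simp: verts_heap)
        moreover have "{n, n div 2} \<in> edges (heap d)" using n heap_edge by blast
        moreover have "reach (heap d) (verts (heap d)) (n div 2) 1" using less.IH[of "n div 2"] calculation n by simp
        ultimately show ?thesis using reach_trans reach_step less.prems by metis
      qed simp
    qed
    then have "reach (heap d) (verts (heap d)) u w"
      using that reach_trans reach_sym by metis
    then show ?thesis using reach_imp_gpath[OF _ that(2)] by blast
  qed
  \<comment> \<open>The largest vertex of a cycle would have two distinct neighbours on it, but a
    smaller neighbour can only be its parent.\<close>
  moreover have "\<not> gcycle (heap d) xs" for xs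
  proof
    assume c: "gcycle (heap d) xs"
    define L where "L = length xs"
    have L: "L \<ge> 3" "distinct xs" using c by (auto simp: gcycle_def gpath_def L_def)
    then have ne: "xs \<noteq> []" by (auto simp: L_def)
    \<comment> \<open>Indices modulo L treat the closing edge like the others.\<close>
    have adj: "{xs ! j, xs ! (Suc j mod L)} \<in> edges (heap d)" if "j < L" for j
    proof (cases "Suc j = L")
      case True
      then have "j = length xs - 1" "Suc j mod L = 0" by (simp_all add: L_def)
      then have "xs ! j = last xs" "xs ! (Suc j mod L) = hd xs"
        using ne by (simp_all add: last_conv_nth hd_conv_nth)
      then show ?thesis using c by (simp add: gcycle_def)
    next
      case False
      then show ?thesis
        using c that successively_nth[of "\<lambda>x y. {x, y} \<in> edges (heap d)" xs j]
        by (simp add: gcycle_def gpath_def L_def)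
    qed
    define m where "m = Max (set xs)"
    have mx: "x \<le> m" if "x \<in> set xs" for x using that by (simp add: m_def)
    have "m \<in> set xs" using ne by (simp add: m_def)
    then obtain i where i: "i < L" "xs ! i = m" by (auto simp: in_set_conv_nth L_def)
    have parent: "x = m div 2" if "x \<in> set xs" "{m, x} \<in> edges (heap d)" for x
      using that mx[OF that(1)] by (auto simp: heap_edge)
    \<comment> \<open>p and n are the cyclic predecessor and successor of i, distinct since L is at
      least 3.\<close>
    define p where "p = (if i = 0 then L - 1 else i - 1)"
    define n where "n = Suc i mod L"
    have pn: "p < L" "n < L" "Suc p mod L = i" "p \<noteq> n"
      using i L by (auto simp: p_def n_def mod_Suc)
    have "{m, xs ! p} \<in> edges (heap d)" "{m, xs ! n} \<in> edges (heap d)"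
      using adj[OF pn(1)] adj[OF i(1)] i(2) unfolding pn(3) n_def by (simp_all add: insert_commute)
    moreover have "xs ! p \<in> set xs" "xs ! n \<in> set xs" using pn by (simp_all add: L_def)
    ultimately have "xs ! p = m div 2" "xs ! n = m div 2" using parent by blast+
    then show False using pn L by (metis nth_eq_iff_index_eq L_def)
  qed
  ultimately show ?thesis by (auto simp: tree_def)
qed

text \<open>The left child \<open>2 * v\<close> goes straight on from the parent of \<open>v\<close>, the right child turns.\<close>

definition heap_port :: "nat \<Rightarrow> nat \<Rightarrow> direction" where
  "heap_port v u = (if v = 1 then (if u = 2 then East else West)
     else if u = v div 2 then East else if u = 2 * v then West else North)"

lemma nbrs_heap: "u \<in> nbrs (heap d) v \<longleftrightarrow>
    2 \<le> v \<and> v < 2 ^ (d + 1) \<and> u = v div 2 \<or> 1 \<le> v \<and> u < 2 ^ (d + 1) \<and> (u = 2 * v \<or> u = 2 * v + 1)"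
  unfolding nbrs_def mem_Collect_eq heap_edge by auto

lemma inj_heap_port: "inj_on (heap_port v) (nbrs (heap d) v)"
  unfolding inj_on_def Ball_def nbrs_heap by (auto simp: heap_port_def split: if_splits)

section \<open>Bends along paths and bounds on \<open>leaf_bends\<close>\<close>

lemma bends_Cons:
  "bends M (x # y # z # zs) = of_bool (horizontal M x y \<noteq> horizontal M y z) + bends M (y # z # zs)"
proof -
  let ?A = "\<lambda>xs. {i. i + 2 < length xs \<and>
     horizontal M (xs ! i) (xs ! (i + 1)) \<noteq> horizontal M (xs ! (i + 1)) (xs ! (i + 2))}"
  let ?xs = "x # y # z # zs" and ?ys = "y # z # zs"
  have fin: "finite (?A ?ys)" by (rule finite_subset[of _ "{..<length ?ys}"]) auto
  have "?A ?xs = (if horizontal M x y \<noteq> horizontal M y z then {0} else {}) \<union> Suc ` ?A ?ys" (is "_ = ?R")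
  proof (rule set_eqI)
    fix i show "i \<in> ?A ?xs \<longleftrightarrow> i \<in> ?R" by (cases i) auto
  qed
  then show ?thesis using fin
    unfolding bends_def by (subst card_Un_disjoint[symmetric] | simp add: card_image card_insert_if)+
qed

lemma bends_short: "length xs \<le> 2 \<Longrightarrow> bends M xs = 0"
  by (simp add: bends_def)

lemma bends_le: "bends M xs \<le> length xs - 2"
proof -
  have "bends M xs \<le> card {..<length xs - 2}"
    unfolding bends_def by (intro card_mono) auto
  then show ?thesis by simp
qed

lemma bends_tl_le: "bends M xs \<le> bends M (x # xs)"
  by (cases xs; cases "tl xs") (auto simp: bends_Cons bends_short)

lemma leaf_bends_ge:
  assumes "tree G" "gpath G v xs f" "leaf G f" "c \<in> set xs"
  shows "bends M xs \<le> leaf_bends G M v c"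
proof -
  let ?X = "{path_bends G M v f | f. leaf G f \<and> c \<in> set (the_path G v f)}"
  have "?X \<subseteq> path_bends G M v ` verts G" by (auto simp: leaf_def)
  then have "finite ?X" using tree_finite[OF assms(1)] finite_surj by blast
  moreover have "bends M xs \<in> ?X"
    using assms the_path_eq[OF assms(1,2)] by (auto simp: path_bends_def)
  ultimately show ?thesis unfolding leaf_bends_def by (rule le_cSup_finite)
qed

text \<open>A path from v that contains c has it right after v, since its part up to c is the unique
  path between them, namely the edge. Each vertex beyond c then adds at most one bend.\<close>

lemma leaf_bends_le:
  assumes "tree G" "{v, c} \<in> edges G"
    and "\<And>ys f. gpath G v (v # c # ys) f \<Longrightarrow> length ys \<le> n"
  shows "leaf_bends G M v c \<le> n"
proof -
  let ?X = "{path_bends G M v f | f. leaf G f \<and> c \<in> set (the_path G v f)}"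
  have "x \<le> n" if x: "x \<in> ?X" for x
  proof -
    obtain f where f: "x = bends M (the_path G v f)" "leaf G f" "c \<in> set (the_path G v f)"
      using x unfolding path_bends_def by blast
    obtain q r where qr: "the_path G v f = q @ c # r" using f(3) by (auto simp: in_set_conv_decomp)
    have p: "gpath G v (q @ c # r) f"
      using tree_gpath[OF assms(1), of v f] f edge_verts[OF assms(1,2)] by (simp add: leaf_def qr)
    then have "successively (\<lambda>x y. {x, y} \<in> edges G) (q @ [c])"
      using successively_append_iff[of _ "q @ [c]" r] by (simp add: gpath_def)
    then have "gpath G v (q @ [c]) c"
      using p by (cases q) (auto simp: gpath_def)
    moreover have "gpath G v [v, c] c" using assms edge_verts[OF assms(1,2)] by (auto simp: gpath_def)
    ultimately have "q @ [c] = [v, c]" using gpath_unique[OF assms(1)] by blast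
    then have "the_path G v f = v # c # r" using qr by (cases q) auto
    then show ?thesis using bends_le[of M "v # c # r"] assms(3)[of r f] p qr f(1) by simp
  qed
  then show ?thesis unfolding leaf_bends_def
    by (rule Sup_nat_le)
qed

text \<open>A simple path that has stepped down cannot go up again, because the only way up is the
  parent it came from. Every step down at least doubles the number.\<close>

lemma heap_descending_path:
  assumes "gpath (heap d) v (v # c # ys) f" "c div 2 = v"
  shows "v * 2 ^ (length ys + 1) \<le> f"
  using assms
proof (induction ys arbitrary: v c)
  case Nil
  then show ?case by (auto simp: gpath_def)
next
  case (Cons z zs)
  have p: "gpath (heap d) c (c # z # zs) f" "{c, z} \<in> edges (heap d)" "v \<noteq> z"
    using Cons.prems by (auto simp: gpath_def)
  then have "z div 2 = c" using Cons.prems by (auto simp: heap_edge)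
  then have "c * 2 ^ (length zs + 1) \<le> f" using Cons.IH p by blast
  moreover have "v * 2 * 2 ^ (length zs + 1) \<le> c * 2 ^ (length zs + 1)"
    using Cons.prems by (intro mult_right_mono) auto
  moreover have "v * 2 ^ (length (z # zs) + 1) = v * 2 * 2 ^ (length zs + 1)" by simp
  ultimately show ?case by linarith
qed

text \<open>Descending only to right children bends at every inner vertex.\<close>

primrec odd_path :: "nat \<Rightarrow> nat \<Rightarrow> nat list" where
  "odd_path 0 c = [c]"
| "odd_path (Suc n) c = c # odd_path n (2 * c + 1)"

lemma odd_path_simps [simp]: "odd_path n c \<noteq> []" "hd (odd_path n c) = c"
  by (cases n; simp)+

lemma odd_path_ge: "x \<in> set (odd_path n c) \<Longrightarrow> x = c \<or> 2 * c + 1 \<le> x"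
proof (induction n arbitrary: c)
  case (Suc n)
  then show ?case using Suc.IH[of "2 * c + 1"] by auto
qed simp

text \<open>Since (2 c + 1) + 1 = 2 (c + 1), the number plus 1 doubles at each step to a right
  child.\<close>

lemma odd_path_gpath:
  assumes "1 \<le> c" "(c + 1) * 2 ^ n \<le> 2 ^ (d + 1)"
  shows "gpath (heap d) c (odd_path n c) ((c + 1) * 2 ^ n - 1)"
  using assms
proof (induction n arbitrary: c)
  case 0
  then show ?case by (auto simp: gpath_def verts_heap)
next
  case (Suc n)
  have eq: "(2 * c + 1 + 1) * 2 ^ n = (c + 1) * 2 ^ Suc n" by (simp add: algebra_simps)
  have IH: "gpath (heap d) (2 * c + 1) (odd_path n (2 * c + 1)) ((c + 1) * 2 ^ Suc n - 1)"
    using Suc.IH[of "2 * c + 1", unfolded eq] Suc.prems by simp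
  have "(c + 1) * 2 \<le> (c + 1) * 2 ^ Suc n" by (intro mult_left_mono) auto
  also have "\<dots> \<le> 2 ^ (d + 1)" using Suc.prems by blast
  finally have lt: "2 * c + 1 < 2 ^ (d + 1)" by simp
  then have "{c, 2 * c + 1} \<in> edges (heap d)" using Suc.prems by (auto simp: heap_edge)
  moreover have "c \<notin> set (odd_path n (2 * c + 1))" using odd_path_ge by fastforce
  moreover have "c \<in> verts (heap d)" using lt Suc.prems by (auto simp: verts_heap)
  ultimately show ?case
    using IH by (auto simp: gpath_def successively_Cons)
qed

text \<open>The vertices of the last level keep only their parent. With d = 0 the root has degree 0,
  hence \<open>d \<ge> 1\<close>.\<close>

lemma leaf_heap: "d \<ge> 1 \<Longrightarrow> 2 ^ d \<le> f \<Longrightarrow> f < 2 ^ (d + 1) \<Longrightarrow> leaf (heap d) f"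
proof -
  assume f: "d \<ge> 1" "2 ^ d \<le> f" "f < 2 ^ (d + 1)"
  have "(2::nat) ^ 1 \<le> 2 ^ d" using f by (intro power_increasing) auto
  then have "2 \<le> f" using f by simp
  then have "nbrs (heap d) f = {f div 2}"
    using f by (intro set_eqI) (auto simp: nbrs_heap)
  then show "leaf (heap d) f" using f \<open>2 \<le> f\<close> by (simp add: leaf_def deg_def verts_heap)
qed

lemma odd_path_bound:
  fixes c :: nat
  assumes "c < 2 ^ (i + 1)" "i \<le> d"
  shows "(c + 1) * 2 ^ (d - i) \<le> 2 ^ (d + 1)"
proof -
  have "(c + 1) * 2 ^ (d - i) \<le> 2 ^ (i + 1) * 2 ^ (d - i)" using assms by (intro mult_right_mono) auto
  also have "\<dots> = 2 ^ (d + 1)" using assms by (simp flip: power_add)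
  finally show ?thesis .
qed

lemma odd_path_leaf:
  assumes "d \<ge> 1" "2 ^ i \<le> c" "c < 2 ^ (i + 1)" "i \<le> d"
  shows "gpath (heap d) c (odd_path (d - i) c) ((c + 1) * 2 ^ (d - i) - 1)"
    "leaf (heap d) ((c + 1) * 2 ^ (d - i) - 1)"
proof -
  have le: "(c + 1) * 2 ^ (d - i) \<le> 2 ^ (d + 1)" using odd_path_bound assms by blast
  have c1: "1 \<le> c" using assms(2) by (metis le_trans one_le_numeral one_le_power)
  then show "gpath (heap d) c (odd_path (d - i) c) ((c + 1) * 2 ^ (d - i) - 1)"
    using odd_path_gpath[OF _ le] by simp
  have "2 ^ i * 2 ^ (d - i) \<le> c * 2 ^ (d - i)" using assms by (intro mult_right_mono) auto
  moreover have "(2::nat) ^ i * 2 ^ (d - i) = 2 ^ d" using assms by (simp flip: power_add)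
  moreover have "(c + 1) * 2 ^ (d - i) = c * 2 ^ (d - i) + 2 ^ (d - i)" by (simp add: algebra_simps)
  moreover have "(1::nat) \<le> 2 ^ (d - i)" by simp
  ultimately have "2 ^ d \<le> (c + 1) * 2 ^ (d - i) - 1" by linarith
  moreover have "(c + 1) * 2 ^ (d - i) - 1 < 2 ^ (d + 1)"
    using le by (rule order.strict_trans2[rotated]) simp
  ultimately show "leaf (heap d) ((c + 1) * 2 ^ (d - i) - 1)" using leaf_heap assms by blast
qed

section \<open>Balance of the complete binary tree\<close>

context
  fixes d :: nat and M :: "nat model" and D :: "nat \<Rightarrow> direction \<Rightarrow> direction"
  assumes d: "d \<ge> 1" and R: "realizes (heap d) heap_port (verts (heap d)) M D"
begin

text \<open>At each of the n inner vertices the parent has port East and the next vertex, a right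
  child, has port North. The first step, from v to c, may go to either child.\<close>

lemma bends_odd_path:
  assumes "1 \<le> v" "c div 2 = v" "(c + 1) * 2 ^ n \<le> 2 ^ (d + 1)"
  shows "bends M (v # odd_path n c) = n"
  using assms
proof (induction n arbitrary: v c)
  case 0
  then show ?case by (simp add: bends_short)
next
  case (Suc n)
  obtain zs where zs: "odd_path n (Suc (2 * c)) = Suc (2 * c) # zs" by (cases n) auto
  have eq: "(2 * c + 1 + 1) * 2 ^ n = (c + 1) * 2 ^ Suc n" by (simp add: algebra_simps)
  have "(c + 1) * 2 \<le> (c + 1) * 2 ^ Suc n" by (intro mult_left_mono) auto
  also have "\<dots> \<le> 2 ^ (d + 1)" using Suc.prems by blast
  finally have lt: "2 * c + 1 < 2 ^ (d + 1)" by simp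
  have c2: "2 \<le> c" using Suc.prems by auto
  have e: "{c, v} \<in> edges (heap d)" "{c, 2 * c + 1} \<in> edges (heap d)"
    using lt c2 Suc.prems by (auto simp: heap_edge)
  have "horizontal M v c \<noteq> horizontal M c (2 * c + 1)"
    using realizes_turn_iff[OF R _ _ _ e] lt c2 Suc.prems
    by (auto simp: verts_heap heap_port_def collinear_dirs_def)
  moreover have "bends M (c # odd_path n (2 * c + 1)) = n"
    using Suc.IH[of c "2 * c + 1", unfolded eq] Suc.prems c2 by simp
  ultimately show ?case by (simp add: bends_Cons zs)
qed

lemma odd_path_from_parent:
  assumes "2 ^ i \<le> v" "v < 2 ^ (i + 1)" "i < d" "c div 2 = v"
  shows "gpath (heap d) v (v # odd_path (d - (i + 1)) c) ((c + 1) * 2 ^ (d - (i + 1)) - 1)"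
    "leaf (heap d) ((c + 1) * 2 ^ (d - (i + 1)) - 1)"
    "bends M (v # odd_path (d - (i + 1)) c) = d - i - 1"
proof -
  have c: "2 ^ (i + 1) \<le> c" "c < 2 ^ (i + 1 + 1)" using assms by auto
  note p = odd_path_leaf[OF d c]
  have v1: "1 \<le> v" using assms(1) by (metis le_trans one_le_numeral one_le_power)
  have le: "(c + 1) * 2 ^ (d - (i + 1)) \<le> 2 ^ (d + 1)"
    using odd_path_bound[OF c(2)] assms by simp
  have "(c + 1) * 1 \<le> (c + 1) * 2 ^ (d - (i + 1))" by (intro mult_left_mono) auto
  also note le
  finally have clt: "c < 2 ^ (d + 1)" by simp
  show "gpath (heap d) v (v # odd_path (d - (i + 1)) c) ((c + 1) * 2 ^ (d - (i + 1)) - 1)"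
    using p(1) assms v1 clt odd_path_ge[of v "d - (i + 1)" c]
    by (auto simp: gpath_def successively_Cons heap_edge verts_heap)
  show "leaf (heap d) ((c + 1) * 2 ^ (d - (i + 1)) - 1)" using p(2) assms by simp
  show "bends M (v # odd_path (d - (i + 1)) c) = d - i - 1"
    using bends_odd_path[OF v1 assms(4) le] by simp
qed

text \<open>The right-descending path attains the value. Conversely, a path down from level i has at
  most d - i edges and so at most d - i - 1 inner vertices.\<close>

lemma leaf_bends_child:
  assumes "2 ^ i \<le> v" "v < 2 ^ (i + 1)" "i < d" "c div 2 = v"
  shows "leaf_bends (heap d) M v c = d - i - 1"
proof (rule antisym)
  note p = odd_path_from_parent[OF assms]
  have "c \<in> set (odd_path (d - (i + 1)) c)" by (metis hd_in_set odd_path_simps)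
  then show "d - i - 1 \<le> leaf_bends (heap d) M v c"
    using leaf_bends_ge[OF tree_heap p(1,2), of c M] p(3) by simp
  have e: "{v, c} \<in> edges (heap d)"
    using p(1) unfolding gpath_def by (cases "d - (i + 1)") auto
  show "leaf_bends (heap d) M v c \<le> d - i - 1"
  proof (rule leaf_bends_le[OF tree_heap e])
    fix ys f assume g: "gpath (heap d) v (v # c # ys) f"
    have "f \<in> verts (heap d)" using g last_in_set unfolding gpath_def by blast
    \<comment> \<open>The level of f is at least i plus the number of steps down, and it cannot
      exceed d.\<close>
    have "(2::nat) ^ (i + length ys + 1) = 2 ^ i * 2 ^ (length ys + 1)" by (simp add: power_add)
    also have "\<dots> \<le> v * 2 ^ (length ys + 1)" using assms by (intro mult_right_mono) auto
    also have "\<dots> \<le> f" using heap_descending_path[OF g assms(4)] .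
    also have "f < 2 ^ (d + 1)" using \<open>f \<in> verts (heap d)\<close> by (simp add: verts_heap)
    finally have "i + length ys + 1 < d + 1" by (simp only: power_strict_increasing_iff)
    then show "length ys \<le> d - i - 1" by simp
  qed
qed

text \<open>Go up and then down through the sibling s: the part from the parent on already has d - i
  bends. This exceeds the d - i - 1 bends below a child, so the parent's branch comes first in the
  order.\<close>

lemma leaf_bends_parent_ge:
  assumes "2 ^ i \<le> v" "v < 2 ^ (i + 1)" "i \<le> d" "2 \<le> v"
  shows "d - i \<le> leaf_bends (heap d) M v (v div 2)"
proof -
  obtain j where j: "i = Suc j" using assms by (cases i) auto
  define s where "s = (if even v then v + 1 else v - 1)"
  have s: "s div 2 = v div 2" "s \<noteq> v" "v \<le> s + 1" "2 \<le> s" using assms by (auto simp: s_def elim!: oddE evenE)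
  have lv: "2 ^ j \<le> v div 2" "v div 2 < 2 ^ (j + 1)" "j < d" using assms j by auto
  note p = odd_path_from_parent[OF lv s(1)]
  have vn: "v \<noteq> v div 2" "v \<notin> set (odd_path (d - (j + 1)) s)"
    using s odd_path_ge[of v "d - (j + 1)" s] assms by auto
  have "(2::nat) ^ (i + 1) \<le> 2 ^ (d + 1)" using assms by (intro power_increasing) auto
  then have vd: "v < 2 ^ (d + 1)" using assms by linarith
  have "gpath (heap d) v (v # v div 2 # odd_path (d - (j + 1)) s) ((s + 1) * 2 ^ (d - (j + 1)) - 1)"
    using p(1) vn vd assms by (auto simp: gpath_def heap_edge verts_heap)
  then have "bends M (v # v div 2 # odd_path (d - (j + 1)) s) \<le> leaf_bends (heap d) M v (v div 2)"
    using leaf_bends_ge[OF tree_heap _ p(2), of v _ "v div 2" M] by simp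
  then show ?thesis using bends_tl_le[of M "v div 2 # odd_path (d - (j + 1)) s" v] p(3) j by simp
qed

lemma heap_nbr_in_dir:
  assumes "v \<in> verts (heap d)"
  shows "nbr_in_dir (heap d) M v (D v p) u \<longleftrightarrow> u \<in> nbrs (heap d) v \<and> heap_port v u = p"
proof (cases "u \<in> nbrs (heap d) v")
  case True
  then have e: "{v, u} \<in> edges (heap d)" by (simp add: nbrs_def)
  then have "towards M v (D v (heap_port v u)) u"
    using R edge_verts[OF tree_heap e] by (auto simp: realizes_def)
  moreover have "nbr_in_dir (heap d) M v (D v p) u \<longleftrightarrow> towards M v (D v p) u"
    using True by (simp add: nbr_in_dir_def towards_def)
  moreover have "rigid (D v)" using R assms by (auto simp: realizes_def)
  ultimately show ?thesis using True towards_unique rigid_eq_iff by metis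
qed (simp add: nbr_in_dir_def)

lemma heap_dir_bends:
  assumes "v \<in> verts (heap d)"
  shows "u \<in> nbrs (heap d) v \<Longrightarrow> heap_port v u = p \<Longrightarrow>
      dir_bends (heap d) M v (D v p) = int (leaf_bends (heap d) M v u)"
    and "(\<And>u. u \<in> nbrs (heap d) v \<Longrightarrow> heap_port v u \<noteq> p) \<Longrightarrow> dir_bends (heap d) M v (D v p) = -1"
proof -
  assume u: "u \<in> nbrs (heap d) v" "heap_port v u = p"
  then have "(THE u. u \<in> nbrs (heap d) v \<and> heap_port v u = p) = u"
    using inj_heap_port[of v d] by (intro the_equality) (auto simp: inj_on_def)
  then show "dir_bends (heap d) M v (D v p) = int (leaf_bends (heap d) M v u)"
    using u unfolding dir_bends_def heap_nbr_in_dir[OF assms] by auto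
qed (auto simp: dir_bends_def heap_nbr_in_dir[OF assms])

lemma balanced_heap: "balanced (heap d) M"
  unfolding balanced_def
proof
  fix v assume v: "v \<in> verts (heap d)"
  then have v1: "1 \<le> v" "v < 2 ^ (d + 1)" by (auto simp: verts_heap)
  obtain i where i: "2 ^ i \<le> v" "v < 2 ^ (i + 1)" using ex_power_ivl1[of 2 v] v1 by auto
  have "(2::nat) ^ i < 2 ^ (d + 1)" using i v1 by linarith
  then have id: "i \<le> d" by (simp only: power_strict_increasing_iff)
  have r: "rigid (D v)" using R v by (auto simp: realizes_def)
  let ?b = "\<lambda>p. dir_bends (heap d) M v (D v p)"
  \<comment> \<open>East holds the parent and West the left child, virtual on the last level; at the
    root they hold the two children. A tie between West and North is broken in favour of
    West.\<close>
  have "?b East \<ge> ?b West \<and> ?b West \<ge> ?b North \<and> ?b North \<ge> ?b South"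
  proof (cases "v = 1")
    case True
    have "i = 0"
    proof (rule ccontr)
      assume "i \<noteq> 0"
      then have "(2::nat) ^ 1 \<le> 2 ^ i" by (intro power_increasing) auto
      then show False using i True by simp
    qed
    have "(2::nat) ^ 2 \<le> 2 ^ (d + 1)" using d by (intro power_increasing) auto
    then have "2 \<in> nbrs (heap d) v" "3 \<in> nbrs (heap d) v" using True by (auto simp: nbrs_heap)
    then have "?b East = int (leaf_bends (heap d) M v 2)" "?b West = int (leaf_bends (heap d) M v 3)"
      "?b North = -1" "?b South = -1"
      using heap_dir_bends[OF v] True by (auto simp: heap_port_def)
    then show ?thesis
      using leaf_bends_child[of 0 v 2] leaf_bends_child[of 0 v 3] d True by simp
  next
    case False
    then have v2: "2 \<le> v" using v1 by simp
    have E: "?b East = int (leaf_bends (heap d) M v (v div 2))"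
      using v1 v2 by (intro heap_dir_bends(1)[OF v]) (auto simp: nbrs_heap heap_port_def)
    have S: "?b South = -1"
      using False by (intro heap_dir_bends(2)[OF v]) (auto simp: heap_port_def)
    show ?thesis
    proof (cases "i = d")
      case True
      have "?b West = -1" "?b North = -1"
        using True i v2 by (intro heap_dir_bends(2)[OF v]; auto simp: nbrs_heap heap_port_def)+
      then show ?thesis using E S by simp
    next
      case False
      then have lt: "i < d" using id by simp
      then have "(2::nat) ^ (i + 2) \<le> 2 ^ (d + 1)" by (intro power_increasing) auto
      then have "2 * v + 1 < 2 ^ (d + 1)" using i by simp
      then have "?b West = int (leaf_bends (heap d) M v (2 * v))" "?b North = int (leaf_bends (heap d) M v (2 * v + 1))"
        using v2 by (intro heap_dir_bends(1)[OF v]; auto simp: nbrs_heap heap_port_def)+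
      then show ?thesis
        using leaf_bends_child[OF i lt, of "2 * v"] leaf_bends_child[OF i lt, of "2 * v + 1"]
          leaf_bends_parent_ge[OF i id v2] E S by simp
    qed
  qed
  then have "sorted_wrt (\<ge>) (map (dir_bends (heap d) M v) (map (D v) [East, West, North, South]))"
    by auto
  moreover have "distinct (map (D v) [East, West, North, South])"
    using r by (simp add: rigid_eq_iff)
  moreover have "collinear_dirs (D v East) (D v West)"
    using r by (simp add: rigid_def collinear_dirs_def)
  ultimately show "balanced_vertex (heap d) M v"
    unfolding balanced_vertex_def by (intro exI[of _ "map (D v) [East, West, North, South]"]) simp
qed

end

section \<open>Sizes of \<open>Tf d\<close> and \<open>Tk k\<close>\<close>

lemma Tf_candidate_heap:
  assumes d: "d \<ge> 1"
  shows "Tf_candidate d (heap d) 1"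
proof -
  obtain M D where R: "realizes (heap d) heap_port (verts (heap d)) M D"
    using exists_realization[OF tree_heap inj_heap_port] by blast
  have "(2::nat) ^ 2 \<le> 2 ^ (d + 1)" using d by (intro power_increasing) auto
  then have "nbrs (heap d) 1 = {2, 3}" "1 \<in> verts (heap d)"
    by (auto simp: nbrs_heap verts_heap)
  moreover have "leaf_bends (heap d) M 1 2 = d - 1" "leaf_bends (heap d) M 1 3 = d - 1"
    using leaf_bends_child[OF d R, of 0 1] d by simp_all
  ultimately show ?thesis
    unfolding Tf_candidate_def
    using tree_heap realizes_s_model[OF tree_heap R] balanced_heap[OF d R]
    by (intro conjI exI[of _ 2] exI[of _ 3] exI[of _ M]) auto
qed

text \<open>A candidate exists, so there is one with the fewest vertices, and the choice in
  \<open>Tf\<close> picks a genuine minimiser.\<close>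

lemma is_Tf_Tf: "is_Tf d (fst (Tf d)) (snd (Tf d))"
proof -
  have "\<exists>G r. is_Tf d G r"
  proof (cases "d = 0")
    case True
    then show ?thesis by (auto simp: is_Tf_def intro!: exI[of _ "\<lparr>verts = {0}, edges = {}\<rparr>"])
  next
    case False
    then have "(\<lambda>(G, r). Tf_candidate d G r) (heap d, 1)" using Tf_candidate_heap by simp
    from ex_has_least_nat[of "\<lambda>(G, r). Tf_candidate d G r", OF this, of "\<lambda>x. card (verts (fst x))"]
    show ?thesis using False by (auto simp: is_Tf_def)
  qed
  then have "\<exists>x. (\<lambda>(G, r). is_Tf d G r) x" by auto
  then have "(\<lambda>(G, r). is_Tf d G r) (Tf d)" unfolding Tf_def by (rule someI_ex)
  then show ?thesis by (simp only: case_prod_beta)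
qed

text \<open>For positive d, minimality compares \<open>Tf d\<close> with the complete binary tree of
  depth d, which has \<open>2 ^ (d + 1) - 1\<close> vertices.\<close>

lemma Tf_verts: "finite (verts (fst (Tf d)))" "card (verts (fst (Tf d))) + 1 \<le> 2 ^ (d + 1)"
proof -
  show "finite (verts (fst (Tf d)))"
    using is_Tf_Tf[of d] tree_finite by (auto simp: is_Tf_def Tf_candidate_def split: if_splits)
  show "card (verts (fst (Tf d))) + 1 \<le> 2 ^ (d + 1)"
  proof (cases "d = 0")
    case True
    then show ?thesis using is_Tf_Tf[of d] by (simp add: is_Tf_def)
  next
    case False
    then have "card (verts (fst (Tf d))) \<le> card (verts (heap d))"
      using is_Tf_Tf[of d] Tf_candidate_heap[of d] by (auto simp: is_Tf_def)
    moreover have "card (verts (heap d)) + 1 = 2 ^ (d + 1)" by (simp add: verts_heap)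
    ultimately show ?thesis by linarith
  qed
qed

lemma card_Tk_le:
  assumes "k \<ge> 1"
  shows "card (verts (Tk k)) \<le> (\<Sum>i=1..k. 2 ^ (min (i - 1) (k - i) + 1)) + 2"
proof -
  let ?F = "\<lambda>i. verts (fst (Tf (min (i - 1) (k - i))))"
  have "verts (Tk k) = Inl ` {0..k + 1} \<union> (\<Union>i\<in>{1..k}. (\<lambda>x. Inr (i, x)) ` ?F i)"
    using assms by (simp add: Tk_def Let_def)
  then have "card (verts (Tk k)) \<le> card ((Inl :: nat \<Rightarrow> nat + nat \<times> nat) ` {0..k + 1}) +
      card (\<Union>i\<in>{1..k}. (\<lambda>x. Inr (i, x)) ` ?F i :: (nat + nat \<times> nat) set)"
    by (simp add: card_Un_le)
  also have "\<dots> \<le> (k + 2) + (\<Sum>i\<in>{1..k}. card ((\<lambda>x. Inr (i, x)) ` ?F i :: (nat + nat \<times> nat) set))"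
    by (intro add_mono card_UN_le) (auto simp: card_image)
  also have "\<dots> \<le> (k + 2) + (\<Sum>i\<in>{1..k}. card (?F i))"
    by (intro add_left_mono sum_mono card_image_le Tf_verts)
  \<comment> \<open>Of the k + 2 path vertices, one is assigned to each of the k copies and 2
    remain.\<close>
  also have "\<dots> = (\<Sum>i\<in>{1..k}. card (?F i) + 1) + 2" by (simp only: sum.distrib) simp
  also have "\<dots> \<le> (\<Sum>i=1..k. 2 ^ (min (i - 1) (k - i) + 1)) + 2"
    by (intro add_right_mono sum_mono Tf_verts)
  finally show ?thesis .
qed

theorem theorem2:
  fixes T :: "'a graph" and k :: nat
  assumes "tree T"
    and "\<forall>v\<in>verts T. deg T v \<le> 4"
    and "bend_number T = k"
  shows "card (verts T) \<ge> card (verts (Tk k))"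
proof (cases "k = 0")
  case True
  have "1 \<le> card (verts T)"
    using assms(1) tree_finite[OF assms(1)] by (auto simp: tree_def Suc_le_eq card_gt_0_iff)
  then show ?thesis using True by (simp add: Tk_def)
next
  case False
  then obtain a b where "a + b \<ge> k" "2 ^ (a + 1) + 2 ^ (b + 1) \<le> card (verts T) + 2"
    using exists_model_bends[OF assms] by auto
  \<comment> \<open>The constants cancel: \<open>Tk k\<close> has at most 2 vertices beyond the sum,
    the sum plus 4 is at most the two powers together, and these are at most
    \<open>card (verts T) + 2\<close>.\<close>
  then show ?thesis using sum_min_le[of k a b] card_Tk_le[of k] False by linarith
qed

end
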